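(* Let $D$ be a domain in $\mathbb R^n$, $n\ge 2$, let $Q:D\to[0,\infty]$ be a Lebesgue measurable function with $Q\in L^1_{\rm loc}(D)$. Let $f_m:D\to\overline{\mathbb R^n}$, $m=1,2,\dots$, be homeomorphisms such that each $f_m$ satisfies the ring $Q$-inequality at every point $x_0\in D$ for radii in $(0,\mathrm{dist}(x_0,\partial D))$. Suppose $f_m\to f:D\to\overline{\mathbb R^n}$ locally uniformly in $D$ with respect to the chordal metric $h$. Then either $f$ is a homeomorphism of $D$ into $\overline{\mathbb R^n}$, or $f$ is a constant $c\in\overline{\mathbb R^n}$. If, in addition, $f_m(x)\ne\infty$ for all $x\in D$ and all $m$, then either $f$ is a homeomorphism of $D$ into $\mathbb R^n$, or $f$ is a constant $c\in\overline{\mathbb R^n}$.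
   Context: $\overline{\mathbb R^n}=\mathbb R^n\cup\{\infty\}$ carries the chordal metric $h(x,y)=\frac{|x-y|}{\sqrt{1+|x|^2}\sqrt{1+|y|^2}}$, $h(x,\infty)=\frac{1}{\sqrt{1+|x|^2}}$ ($x,y\ne\infty$). Notation: $S(x_0,r)=\{x\in\mathbb R^n:|x-x_0|=r\}$, $A(x_0,r_1,r_2)=\{x\in\mathbb R^n:r_1<|x-x_0|<r_2\}$. For $E,F,G\subset\overline{\mathbb R^n}$, $\Gamma(E,F,G)$ denotes the family of all paths $\gamma:[a,b]\to\overline{\mathbb R^n}$ with $\gamma(a)\in E$, $\gamma(b)\in F$ and $\gamma(t)\in G$ for $a<t<b$; $f(\Gamma)=\{f\circ\gamma:\gamma\in\Gamma\}$. $M(\Gamma)$ is the conformal modulus: the infimum of $\int_{\mathbb R^n}\rho^n\,dm$ over Borel functions $\rho\ge0$ with $\int_\gamma\rho\,ds\ge1$ for every locally rectifiable $\gamma\in\Gamma$. Ring $Q$-inequality: with $Q$ extended by $0$ outside $D$, a mapping $f:D\to\overline{\mathbb R^n}$ satisfies the ring $Q$-inequality at $x_0\in D$ for radii in $(0,R)$ if $M\big(f(\Gamma(S(x_0,r_1),S(x_0,r_2),D))\big)\le\int_{A(x_0,r_1,r_2)\cap D}Q(x)\,\eta^n(|x-x_0|)\,dm(x)$ for all $0<r_1<r_2<R$ and all Lebesgue measurable $\eta:(r_1,r_2)\to[0,\infty]$ with $\int_{r_1}^{r_2}\eta(r)\,dr\ge1$. *)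

theory Defs
  imports "HOL-Analysis.Analysis"
begin

text \<open>The extended space \<open>\<overline>R^n\<close> is modelled by \<open>'a option\<close>, where \<open>'a\<close> is a Euclidean
  space of dimension n, \<open>Some x\<close> is the point x and \<open>None\<close> is the point at infinity.\<close>

definition chordal :: "'a::euclidean_space option \<Rightarrow> 'a option \<Rightarrow> real" where
  "chordal p q = (case (p, q) of
      (Some x, Some y) \<Rightarrow> norm (x - y) / (sqrt (1 + (norm x)\<^sup>2) * sqrt (1 + (norm y)\<^sup>2))
    | (Some x, None) \<Rightarrow> 1 / sqrt (1 + (norm x)\<^sup>2)
    | (None, Some y) \<Rightarrow> 1 / sqrt (1 + (norm y)\<^sup>2)
    | (None, None) \<Rightarrow> 0)"

definition path_length :: "(real \<Rightarrow> 'a::euclidean_space) \<Rightarrow> real \<Rightarrow> real \<Rightarrow> ennreal" where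
  "path_length p c d =
     (SUP ts \<in> {ts. sorted ts \<and> set ts \<subseteq> {c..d}}.
        ennreal (\<Sum>i<length ts - 1. dist (p (ts ! i)) (p (ts ! Suc i))))"

definition rectifiable_on :: "(real \<Rightarrow> 'a::euclidean_space) \<Rightarrow> real \<Rightarrow> real \<Rightarrow> bool" where
  "rectifiable_on p c d \<longleftrightarrow> path_length p c d < \<infinity>"

text \<open>Line integral \<open>\<integral>_p \<rho> ds\<close> of a Borel function \<open>\<rho> \<ge> 0\<close> along the (rectifiable) path
  \<open>p|[c,d]\<close>, as the Lebesgue--Stieltjes integral of \<open>\<rho> \<circ> p\<close> with respect to the length
  function \<open>s(t) = \<ell>(p|[c,t])\<close>.\<close>
definition line_integral :: "('a::euclidean_space \<Rightarrow> ennreal) \<Rightarrow> (real \<Rightarrow> 'a) \<Rightarrow> real \<Rightarrow> real \<Rightarrow> ennreal" where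
  "line_integral \<rho> p c d =
     (\<integral>\<^sup>+ t. indicator {c..d} t * \<rho> (p t)
        \<partial>interval_measure (\<lambda>t. enn2real (path_length p c (max c (min t d)))))"

text \<open>A path in \<open>\<overline>R^n\<close> is a triple \<open>(a, b, g)\<close> meaning \<open>g : [a,b] \<rightarrow> \<overline>R^n\<close>.
  It is locally rectifiable if each closed subpath lying in \<open>R^n\<close> is rectifiable, and
  the line integral over it is the integral over its part in \<open>R^n\<close>
  (sum over the components, computed as a supremum over finite disjoint closed subpaths in \<open>R^n\<close>).\<close>
definition in_Rn_on :: "(real \<Rightarrow> 'a option) \<Rightarrow> real \<Rightarrow> real \<Rightarrow> bool" where
  "in_Rn_on g c d \<longleftrightarrow> (\<forall>t\<in>{c..d}. g t \<noteq> None)"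

definition loc_rectifiable :: "real \<Rightarrow> real \<Rightarrow> (real \<Rightarrow> 'a::euclidean_space option) \<Rightarrow> bool" where
  "loc_rectifiable a b g \<longleftrightarrow>
     (\<forall>c d. a \<le> c \<and> c \<le> d \<and> d \<le> b \<and> in_Rn_on g c d \<longrightarrow> rectifiable_on (the \<circ> g) c d)"

definition ext_line_integral ::
    "('a::euclidean_space \<Rightarrow> ennreal) \<Rightarrow> real \<Rightarrow> real \<Rightarrow> (real \<Rightarrow> 'a option) \<Rightarrow> ennreal" where
  "ext_line_integral \<rho> a b g =
     (SUP I \<in> {I. finite I \<and> (\<forall>(c, d)\<in>I. a \<le> c \<and> c \<le> d \<and> d \<le> b \<and> in_Rn_on g c d)
                  \<and> disjoint_family_on (\<lambda>(c, d). {c..d}) I}.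
        \<Sum>(c, d)\<in>I. line_integral \<rho> (the \<circ> g) c d)"

definition modulus :: "(real \<times> real \<times> (real \<Rightarrow> 'a::euclidean_space option)) set \<Rightarrow> ennreal" where
  "modulus \<Gamma> =
     (INF \<rho> \<in> {\<rho> :: 'a \<Rightarrow> ennreal. \<rho> \<in> borel_measurable borel \<and>
                 (\<forall>(a, b, g)\<in>\<Gamma>. loc_rectifiable a b g \<longrightarrow> 1 \<le> ext_line_integral \<rho> a b g)}.
        \<integral>\<^sup>+ x. \<rho> x ^ DIM('a) \<partial>lborel)"

definition path_family :: "'a::euclidean_space set \<Rightarrow> 'a set \<Rightarrow> 'a set \<Rightarrow> (real \<times> real \<times> (real \<Rightarrow> 'a)) set" where
  "path_family E F G = {(a, b, \<gamma>). a \<le> b \<and> continuous_on {a..b} \<gamma> \<and>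
        \<gamma> a \<in> E \<and> \<gamma> b \<in> F \<and> (\<forall>t\<in>{a<..<b}. \<gamma> t \<in> G)}"

definition image_family ::
    "('a \<Rightarrow> 'b) \<Rightarrow> (real \<times> real \<times> (real \<Rightarrow> 'a)) set \<Rightarrow> (real \<times> real \<times> (real \<Rightarrow> 'b)) set" where
  "image_family f \<Gamma> = (\<lambda>(a, b, \<gamma>). (a, b, f \<circ> \<gamma>)) ` \<Gamma>"

definition annulus :: "'a::euclidean_space \<Rightarrow> real \<Rightarrow> real \<Rightarrow> 'a set" where
  "annulus x0 r1 r2 = {x. r1 < dist x x0 \<and> dist x x0 < r2}"

definition dist_boundary :: "'a::euclidean_space set \<Rightarrow> 'a \<Rightarrow> ereal" where
  "dist_boundary D x0 = (if frontier D = {} then \<infinity> else ereal (infdist x0 (frontier D)))"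

definition ring_Q_ineq ::
    "'a::euclidean_space set \<Rightarrow> ('a \<Rightarrow> ennreal) \<Rightarrow> ('a \<Rightarrow> 'a option) \<Rightarrow> 'a \<Rightarrow> ereal \<Rightarrow> bool" where
  "ring_Q_ineq D Q f x0 R \<longleftrightarrow>
     (\<forall>r1 r2 \<eta>. 0 < r1 \<and> r1 < r2 \<and> ereal r2 < R \<and> \<eta> \<in> borel_measurable lebesgue \<and>
        1 \<le> (\<integral>\<^sup>+ r\<in>{r1<..<r2}. \<eta> r \<partial>lborel) \<longrightarrow>
        modulus (image_family f (path_family (sphere x0 r1) (sphere x0 r2) D))
          \<le> (\<integral>\<^sup>+ x\<in>annulus x0 r1 r2 \<inter> D. Q x * \<eta> (dist x x0) ^ DIM('a) \<partial>lebesgue))"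

definition Lloc1_on :: "'a::euclidean_space set \<Rightarrow> ('a \<Rightarrow> ennreal) \<Rightarrow> bool" where
  "Lloc1_on D Q \<longleftrightarrow> (\<forall>K. compact K \<and> K \<subseteq> D \<longrightarrow> (\<integral>\<^sup>+ x\<in>K. Q x \<partial>lebesgue) < \<infinity>)"

definition chordal_continuous_on :: "'a::euclidean_space set \<Rightarrow> ('a \<Rightarrow> 'a option) \<Rightarrow> bool" where
  "chordal_continuous_on D f \<longleftrightarrow>
     (\<forall>x\<in>D. \<forall>e>0. \<exists>d>0. \<forall>y\<in>D. dist y x < d \<longrightarrow> chordal (f y) (f x) < e)"

definition chordal_homeo_into :: "'a::euclidean_space set \<Rightarrow> ('a \<Rightarrow> 'a option) \<Rightarrow> bool" where
  "chordal_homeo_into D f \<longleftrightarrow> inj_on f D \<and> chordal_continuous_on D f \<and>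
     (\<forall>x\<in>D. \<forall>e>0. \<exists>d>0. \<forall>y\<in>D. chordal (f y) (f x) < d \<longrightarrow> dist y x < e)"

definition chordal_locally_uniform :: "'a::euclidean_space set \<Rightarrow> (nat \<Rightarrow> 'a \<Rightarrow> 'a option) \<Rightarrow> ('a \<Rightarrow> 'a option) \<Rightarrow> bool" where
  "chordal_locally_uniform D fs f \<longleftrightarrow>
     (\<forall>x\<in>D. \<exists>r>0. ball x r \<subseteq> D \<and>
        (\<forall>e>0. \<exists>N. \<forall>m\<ge>N. \<forall>y\<in>ball x r. chordal (fs m y) (f y) < e))"

end

theory Submission
  imports Defs
begin

text \<open>A value \<open>c\<close> that \<open>f\<close> takes (or approaches) both in \<open>cball x0 r1\<close> and off \<open>ball x0 r2\<close>
  makes the images under \<open>f\<^sub>m\<close> of these two connected sets come arbitrarily close. If \<open>f\<close> is not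
  constant on either of them, both images cross all spheres \<open>S(c,t)\<close>, \<open>t1 \<le> t \<le> t2\<close>, with \<open>t2/t1\<close>
  as large as we please (spheres \<open>S(0,t)\<close> if \<open>c = \<infinity>\<close>), and then the modulus of the paths joining them
  is at least a constant times \<open>ln (t2/t1)\<close>. The ring inequality with constant \<open>\<eta>\<close> bounds the same
  modulus independently of \<open>m\<close>, so \<open>f\<close> is constant on one of the two sets. This rigidity gives the
  dichotomy as well as the continuity of the inverse.

  For the lower bound, points \<open>a, b \<in> S(p,t)\<close> of the two sets are joined through a third point \<open>z\<close>
  by two segments. Averaging over \<open>z\<close> yields a Riesz type potential of \<open>\<rho>\<^sup>n\<close> at \<open>a\<close> and \<open>b\<close>, in which
  \<open>\<bar>w - a\<bar> \<ge> \<bar>\<bar>w - p\<bar> - t\<bar>\<close> removes the (non-measurable) dependence on the choice of \<open>a, b\<close>;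
  integrating over \<open>t\<close> against \<open>dt/t\<close> concludes.\<close>

section \<open>Line integrals along Lipschitz paths\<close>

text \<open>Replacing each partition point \<open>x\<close> by \<open>min t x\<close> costs a step
  at most \<open>L\<close> times its part beyond \<open>t\<close>, and these parts telescope to at
  most \<open>d - t\<close>.\<close>

lemma sorted_dist_sum_le:
  fixes p :: "real \<Rightarrow> 'a::euclidean_space"
  assumes lip: "\<And>u v. u \<in> {c..d} \<Longrightarrow> v \<in> {c..d} \<Longrightarrow> dist (p u) (p v) \<le> L * \<bar>u - v\<bar>"
    and L: "0 \<le> L" and t: "c \<le> t" "t \<le> d" and ts: "sorted ts" "set ts \<subseteq> {c..d}"
  shows "(\<Sum>i<length ts - 1. dist (p (ts ! i)) (p (ts ! Suc i)))
    \<le> (\<Sum>i<length ts - 1. dist (p (min t (ts ! i))) (p (min t (ts ! Suc i)))) + L * (d - t)"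
proof -
  define \<phi> where "\<phi> x = max 0 (x - t)" for x
  have "(\<Sum>i<length ts - 1. dist (p (ts ! i)) (p (ts ! Suc i)))
    \<le> (\<Sum>i<length ts - 1. dist (p (min t (ts ! i))) (p (min t (ts ! Suc i)))
          + L * (\<phi> (ts ! Suc i) - \<phi> (ts ! i)))"
  proof (rule sum_mono)
    fix i assume i: "i \<in> {..<length ts - 1}"
    define u v where "u = ts ! i" and "v = ts ! Suc i"
    have uv: "u \<in> {c..d}" "v \<in> {c..d}" "u \<le> v"
      using ts i sorted_nth_mono[OF ts(1), of i "Suc i"]
      by (auto simp: u_def v_def subset_iff)
    have tc: "t \<in> {c..d}" using t by auto
    consider "v \<le> t" | "u \<le> t" "t \<le> v" | "t \<le> u" by linarith
    then have "dist (p u) (p v) \<le> dist (p (min t u)) (p (min t v)) + L * (\<phi> v - \<phi> u)"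
    proof cases
      case 1 then show ?thesis using uv by (simp add: \<phi>_def min_def)
    next
      case 2
      then have "dist (p u) (p v) \<le> dist (p u) (p t) + L * (v - t)"
        using dist_triangle[of "p u" "p v" "p t"] lip[OF tc uv(2)] by simp
      then show ?thesis using 2 by (cases "u = t") (simp_all add: \<phi>_def min_def)
    next
      case 3
      then show ?thesis using uv lip[OF uv(1,2)] by (simp add: \<phi>_def min_def)
    qed
    then show "dist (p (ts ! i)) (p (ts ! Suc i)) \<le> dist (p (min t (ts ! i))) (p (min t (ts ! Suc i)))
          + L * (\<phi> (ts ! Suc i) - \<phi> (ts ! i))" by (simp add: u_def v_def)
  qed
  also have "\<dots> = (\<Sum>i<length ts - 1. dist (p (min t (ts ! i))) (p (min t (ts ! Suc i))))
      + L * (\<phi> (ts ! (length ts - 1)) - \<phi> (ts ! 0))"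
    by (simp add: sum.distrib sum_distrib_left[symmetric]
        sum_lessThan_telescope[of "\<lambda>i. \<phi> (ts ! i)", simplified])
  also have "L * (\<phi> (ts ! (length ts - 1)) - \<phi> (ts ! 0)) \<le> L * (d - t)"
  proof (rule mult_left_mono[OF _ L])
    show "\<phi> (ts ! (length ts - 1)) - \<phi> (ts ! 0) \<le> d - t"
    \<comment> \<open>For the empty list both entries are the same term \<open>[] ! 0\<close>, so
      the difference vanishes.\<close>
    proof (cases "ts = []")
      case False
      then have "ts ! (length ts - 1) \<in> set ts" by (intro nth_mem) simp
      then have "ts ! (length ts - 1) \<le> d" using ts(2) by auto
      then show ?thesis using t by (auto simp: \<phi>_def)
    qed (use t in \<open>auto simp: \<phi>_def\<close>)
  qed
  finally show ?thesis by simp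
qed

text \<open>The truncated partition is an admissible partition of \<open>{c..t}\<close>, since
  points may repeat. This bounds the growth of the length function without appeal to additivity of
  length.\<close>

lemma path_length_Lipschitz_add:
  fixes p :: "real \<Rightarrow> 'a::euclidean_space"
  assumes lip: "\<And>u v. u \<in> {c..d} \<Longrightarrow> v \<in> {c..d} \<Longrightarrow> dist (p u) (p v) \<le> L * \<bar>u - v\<bar>"
    and L: "0 \<le> L" and t: "c \<le> t" "t \<le> d"
  shows "path_length p c d \<le> path_length p c t + ennreal (L * (d - t))"
  unfolding path_length_def[of p c d]
proof (rule SUP_least, clarify)
  fix ts assume ts: "sorted ts" "set ts \<subseteq> {c..d}"
  let ?us = "map (min t) ts"
  have us: "sorted ?us" "set ?us \<subseteq> {c..t}"
    unfolding sorted_map by (rule sorted_wrt_mono_rel[OF _ ts(1)]) (use ts t in auto)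
  have "ennreal (\<Sum>i<length ts - 1. dist (p (ts ! i)) (p (ts ! Suc i)))
    \<le> ennreal ((\<Sum>i<length ts - 1. dist (p (min t (ts ! i))) (p (min t (ts ! Suc i)))) + L * (d - t))"
    by (rule ennreal_leI[OF sorted_dist_sum_le[OF lip L t ts]])
  also have "\<dots> = ennreal (\<Sum>i<length ?us - 1. dist (p (?us ! i)) (p (?us ! Suc i))) + ennreal (L * (d - t))"
    using L t by (subst ennreal_plus) (auto intro!: sum_nonneg sum.cong)
  also have "\<dots> \<le> path_length p c t + ennreal (L * (d - t))"
    unfolding path_length_def using us by (intro add_right_mono SUP_upper) auto
  finally show "ennreal (\<Sum>i<length ts - 1. dist (p (ts ! i)) (p (ts ! Suc i)))
    \<le> path_length p c t + ennreal (L * (d - t))" .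
qed

lemma path_length_mono:
  "t \<le> t' \<Longrightarrow> path_length p c t \<le> path_length p c t'"
  unfolding path_length_def by (rule SUP_subset_mono) auto

lemma path_length_self: "path_length p c c = 0"
proof -
  have "(\<Sum>i<length ts - 1. dist (p (ts ! i)) (p (ts ! Suc i))) = 0" if "set ts \<subseteq> {c..c}" for ts
  proof (rule sum.neutral, clarify)
    fix i assume "i < length ts - 1"
    then have "ts ! i \<in> {c..c}" "ts ! Suc i \<in> {c..c}" using that nth_mem[of i ts] nth_mem[of "Suc i" ts]
      by (metis Suc_lessD less_diff_conv Suc_eq_plus1 subsetD)+
    then show "dist (p (ts ! i)) (p (ts ! Suc i)) = 0" by simp
  qed
  then show ?thesis unfolding path_length_def
    by (intro antisym SUP_least) auto
qed

lemma path_length_Lipschitz: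
  fixes p :: "real \<Rightarrow> 'a::euclidean_space"
  assumes "\<And>u v. u \<in> {c..d} \<Longrightarrow> v \<in> {c..d} \<Longrightarrow> dist (p u) (p v) \<le> L * \<bar>u - v\<bar>"
    and "0 \<le> L" "c \<le> d"
  shows "path_length p c d \<le> ennreal (L * (d - c))"
  using path_length_Lipschitz_add[OF assms(1) assms(2) order_refl assms(3)] by (simp add: path_length_self)

text \<open>The complementary function \<open>L t - F t\<close> is a distribution function as well, and the two
  measures add up to \<open>L\<close> times Lebesgue measure.\<close>
lemma interval_measure_Lipschitz_le:
  fixes F :: "real \<Rightarrow> real"
  assumes mono: "\<And>x y. x \<le> y \<Longrightarrow> F x \<le> F y"
    and lip: "\<And>x y. x \<le> y \<Longrightarrow> F y - F x \<le> L * (y - x)" and L: "0 < L"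
  shows "interval_measure F \<le> scale_measure (ennreal L) lborel"
proof -
  define G where "G t = L * t - F t" for t
  have Gm: "G x \<le> G y" if "x \<le> y" for x y using lip[OF that] by (simp add: G_def algebra_simps)
  have "L-lipschitz_on UNIV F"
  proof (rule lipschitz_onI)
    fix x y
    show "dist (F x) (F y) \<le> L * dist x y"
      using lip[of x y] lip[of y x] mono[of x y] mono[of y x]
      by (cases "x \<le> y") (auto simp: dist_real_def)
  qed (use L in simp)
  then have Fc: "continuous_on UNIV F" by (rule lipschitz_on_continuous_on)
  then have Gc: "continuous_on UNIV G" unfolding G_def by (intro continuous_intros)
  have Fa: "isCont F x" for x using Fc continuous_on_eq_continuous_at open_UNIV by blast
  have Ga: "isCont G x" for x using Gc continuous_on_eq_continuous_at open_UNIV by blast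
  \<comment> \<open>\<open>lborel_eqI\<close> tests on open boxes, while interval measures are given
    on half-open intervals; by continuity of \<open>H\<close> the right end point carries no
    mass.\<close>
  have Icc: "emeasure (interval_measure H) {a<..<b} = ennreal (H b - H a)"
    if "a \<le> b" "\<And>x y. x \<le> y \<Longrightarrow> H x \<le> H y" "\<And>x. isCont H x" for H a b
  proof -
    have r: "continuous (at_right x) H" for x using that(3) continuous_at_imp_continuous_at_within by blast
    have 1: "emeasure (interval_measure H) {a<..b} = ennreal (H b - H a)"
      using that r by (intro emeasure_interval_measure_Ioc) auto
    have 2: "emeasure (interval_measure H) {b} = 0"
      using emeasure_interval_measure_Icc[of b b H] that
        continuous_at_imp_continuous_on[of UNIV H] by simp
    show ?thesis
    proof (cases "a < b")
      case True
      then have "{a<..b} = {a<..<b} \<union> {b}" by auto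
      then have "emeasure (interval_measure H) {a<..b}
          = emeasure (interval_measure H) {a<..<b} + emeasure (interval_measure H) {b}"
        using plus_emeasure[of "{a<..<b}" "interval_measure H" "{b}"] by simp
      then show ?thesis using 1 2 by simp
    qed (use that(1) in auto)
  qed
  \<comment> \<open>Since \<open>F t + G t = L * t\<close>, the normalised sum gives each box its
    length, so it is Lebesgue measure; dropping the nonnegative share of \<open>G\<close> leaves the
    bound for \<open>F\<close>.\<close>
  define M where "M = measure_of UNIV (sets borel) (\<lambda>A. ennreal (1/L) *
     (emeasure (interval_measure F) A + emeasure (interval_measure G) A))"
  have sM: "sets M = sets borel" unfolding M_def
    by (metis sets.sets_measure_of_eq space_borel)
  have eM: "emeasure M A = ennreal (1/L) *
     (emeasure (interval_measure F) A + emeasure (interval_measure G) A)" if "A \<in> sets borel" for A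
    using M_def
  proof (rule emeasure_measure_of)
    show "sets borel \<subseteq> Pow (UNIV::real set)" by simp
    show "positive (sets M) (\<lambda>A. ennreal (1/L) *
     (emeasure (interval_measure F) A + emeasure (interval_measure G) A))" by (simp add: positive_def)
    show "A \<in> sets M" using that sM by simp
    show "countably_additive (sets M) (\<lambda>A. ennreal (1/L) *
     (emeasure (interval_measure F) A + emeasure (interval_measure G) A))"
      unfolding sM
      by (rule countably_additiveI) (simp add: ennreal_suminf_cmult suminf_emeasure suminf_add[symmetric] image_subset_iff)
  qed
  have "lborel = M"
  proof (rule lborel_eqI)
    fix l u :: real assume "\<And>b. b \<in> Basis \<Longrightarrow> l \<bullet> b \<le> u \<bullet> b"
    then have lu: "l \<le> u" by simp
    have "emeasure M (box l u) = ennreal (1/L) * (ennreal (F u - F l) + ennreal (G u - G l))"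
      using lu mono Gm Fa Ga by (subst eM) (auto simp: Icc)
    also have "\<dots> = ennreal ((1/L) * ((F u - F l) + (G u - G l)))"
      using lu mono[OF lu] Gm[OF lu] L by (subst ennreal_mult) (auto simp: ennreal_plus)
    also have "(1/L) * ((F u - F l) + (G u - G l)) = u - l"
      using L by (simp add: G_def field_simps)
    finally show "emeasure M (box l u) = (\<Prod>b\<in>Basis. (u - l) \<bullet> b)" by simp
  qed (rule sM)
  then have "emeasure (interval_measure F) A \<le> emeasure (scale_measure (ennreal L) lborel) A"
    if "A \<in> sets borel" for A
  proof -
    have "ennreal L * emeasure lborel A
        = (ennreal L * ennreal (1/L)) * (emeasure (interval_measure F) A + emeasure (interval_measure G) A)"
      using eM[OF that] \<open>lborel = M\<close> by (simp add: mult.assoc)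
    also have "ennreal L * ennreal (1/L) = 1" using L by (simp add: ennreal_mult[symmetric])
    finally show ?thesis by simp
  qed
  then show ?thesis by (subst le_measure) auto
qed

text \<open>The length function is \<open>L\<close>-Lipschitz, so its Stieltjes measure is dominated
  by \<open>L\<close> times Lebesgue measure.\<close>

lemma line_integral_Lipschitz_le:
  fixes p :: "real \<Rightarrow> 'a::euclidean_space"
  assumes lip: "\<And>u v. u \<in> {c..d} \<Longrightarrow> v \<in> {c..d} \<Longrightarrow> dist (p u) (p v) \<le> L * \<bar>u - v\<bar>"
    and L: "0 < L" and cd: "c \<le> d"
    and [measurable]: "\<rho> \<in> borel_measurable borel"
  shows "line_integral \<rho> p c d \<le> ennreal L * (\<integral>\<^sup>+t\<in>{c..d}. \<rho> (p t) \<partial>lborel)"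
proof -
  \<comment> \<open>Clamping the argument to \<open>{c..d}\<close> makes \<open>s\<close> monotone
    and Lipschitz on the whole line. Finiteness of the lengths matters because
    \<open>enn2real\<close> sends infinity to 0.\<close>
  define s where "s t = enn2real (path_length p c (max c (min t d)))" for t
  have fin: "path_length p c t < top" if "t \<le> d" "c \<le> t" for t
    by (rule le_less_trans[OF path_length_Lipschitz[OF lip]]) (use that L in auto)
  have lip': "\<And>u v. u \<in> {c..y} \<Longrightarrow> v \<in> {c..y} \<Longrightarrow> dist (p u) (p v) \<le> L * \<bar>u - v\<bar>" if "y \<le> d" for y
    using lip that by auto
  have sm: "s x \<le> s y" if "x \<le> y" for x y
    unfolding s_def using that cd fin[of "max c (min y d)"]
    by (intro enn2real_mono path_length_mono) (auto simp: less_top[symmetric])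
  have sl: "s y - s x \<le> L * (y - x)" if "x \<le> y" for x y
  proof -
    define x' y' where "x' = max c (min x d)" and "y' = max c (min y d)"
    have xy: "c \<le> x'" "x' \<le> y'" "y' \<le> d" "y' - x' \<le> y - x"
      using cd that by (auto simp: x'_def y'_def)
    have "path_length p c y' \<le> path_length p c x' + ennreal (L * (y' - x'))"
      by (rule path_length_Lipschitz_add[OF lip']) (use xy L in auto)
    then have "enn2real (path_length p c y') \<le> enn2real (path_length p c x' + ennreal (L * (y' - x')))"
      using fin[of x'] xy by (intro enn2real_mono) auto
    also have "\<dots> = enn2real (path_length p c x') + L * (y' - x')"
      using fin[of x'] xy L by (subst enn2real_plus) auto
    also have "L * (y' - x') \<le> L * (y - x)" using xy L by simp
    finally show ?thesis by (simp add: s_def x'_def y'_def)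
  qed
  have "L-lipschitz_on {c..d} p"
    using lip L by (intro lipschitz_onI) (auto simp: dist_real_def)
  then have "continuous_on {c..d} p" by (rule lipschitz_on_continuous_on)
  then have [measurable]: "p \<in> borel_measurable (restrict_space borel {c..d})"
    by (rule borel_measurable_continuous_on_restrict)
  have [measurable]: "(\<lambda>t. indicator {c..d} t * \<rho> (p t)) \<in> borel_measurable borel"
    by (subst mult.commute, subst borel_measurable_restrict_space_iff_ennreal[symmetric]) auto
  have "line_integral \<rho> p c d \<le> (\<integral>\<^sup>+ t. indicator {c..d} t * \<rho> (p t) \<partial>scale_measure (ennreal L) lborel)"
    unfolding line_integral_def s_def[symmetric]
    by (rule nn_integral_mono_measure[OF _ interval_measure_Lipschitz_le[OF sm sl L]]) simp_all
  also have "\<dots> = ennreal L * (\<integral>\<^sup>+ t. indicator {c..d} t * \<rho> (p t) \<partial>lborel)"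
    by (rule nn_integral_scale_measure) simp
  finally show ?thesis by (simp add: mult.commute)
qed

text \<open>The closed subintervals are disjoint, so their indicators sum to at most the indicator
  of \<open>{a..b}\<close>.\<close>

lemma ext_line_integral_Lipschitz_le:
  fixes \<beta> :: "real \<Rightarrow> 'a::euclidean_space"
  assumes lip: "\<And>u v. dist (\<beta> u) (\<beta> v) \<le> L * \<bar>u - v\<bar>" and L: "0 < L"
    and g: "\<And>t. t \<in> {a..b} \<Longrightarrow> g t = Some (\<beta> t)"
    and [measurable]: "\<rho> \<in> borel_measurable borel"
  shows "ext_line_integral \<rho> a b g \<le> ennreal L * (\<integral>\<^sup>+t\<in>{a..b}. \<rho> (\<beta> t) \<partial>lborel)"
  unfolding ext_line_integral_def
proof (rule SUP_least, clarify)
  fix I :: "(real \<times> real) set"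
  assume fin: "finite I" and I: "\<forall>(c, d)\<in>I. a \<le> c \<and> c \<le> d \<and> d \<le> b \<and> in_Rn_on g c d"
    and dj: "disjoint_family_on (\<lambda>(c, d). {c..d}) I"
  have "L-lipschitz_on UNIV \<beta>"
    using lip L by (intro lipschitz_onI) (auto simp: dist_real_def)
  then have "continuous_on UNIV \<beta>" by (rule lipschitz_on_continuous_on)
  then have [measurable]: "\<beta> \<in> borel_measurable borel" by (rule borel_measurable_continuous_onI)
  have "line_integral \<rho> (the \<circ> g) c d \<le> ennreal L * (\<integral>\<^sup>+t\<in>{c..d}. \<rho> (\<beta> t) \<partial>lborel)"
    if "(c, d) \<in> I" for c d
  proof -
    have cd: "a \<le> c" "c \<le> d" "d \<le> b" using I that by auto
    have "line_integral \<rho> (the \<circ> g) c d \<le> ennreal L * (\<integral>\<^sup>+t\<in>{c..d}. \<rho> ((the \<circ> g) t) \<partial>lborel)"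
      using cd lip g by (intro line_integral_Lipschitz_le[OF _ L]) auto
    also have "(\<integral>\<^sup>+t\<in>{c..d}. \<rho> ((the \<circ> g) t) \<partial>lborel) = (\<integral>\<^sup>+t\<in>{c..d}. \<rho> (\<beta> t) \<partial>lborel)"
      using cd g by (intro nn_integral_cong) (auto simp: indicator_def)
    finally show ?thesis .
  qed
  then have "(\<Sum>(c, d)\<in>I. line_integral \<rho> (the \<circ> g) c d)
      \<le> (\<Sum>(c, d)\<in>I. ennreal L * (\<integral>\<^sup>+t\<in>{c..d}. \<rho> (\<beta> t) \<partial>lborel))"
    by (intro sum_mono) auto
  also have "\<dots> = ennreal L * (\<integral>\<^sup>+t. (\<Sum>(c,d)\<in>I. \<rho> (\<beta> t) * indicator {c..d} t) \<partial>lborel)"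
    by (subst nn_integral_sum) (auto simp: sum_distrib_left case_prod_beta)
  also have "\<dots> \<le> ennreal L * (\<integral>\<^sup>+t\<in>{a..b}. \<rho> (\<beta> t) \<partial>lborel)"
  proof (intro mult_left_mono nn_integral_mono)
    fix t
    have "(\<Sum>(c,d)\<in>I. \<rho> (\<beta> t) * indicator {c..d} t) = \<rho> (\<beta> t) * (\<Sum>i\<in>I. indicator ((\<lambda>(c,d). {c..d}) i) t)"
      by (simp add: sum_distrib_left case_prod_beta)
    also have "(\<Sum>i\<in>I. indicator ((\<lambda>(c,d). {c..d}) i) t) = (indicator (\<Union>i\<in>I. (\<lambda>(c,d). {c..d}) i) t :: ennreal)"
      using indicator_UN_disjoint[OF fin dj] by metis
    also have "\<dots> \<le> indicator {a..b} t"
      using I by (intro indicator_leI) fastforce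
    finally show "(\<Sum>(c,d)\<in>I. \<rho> (\<beta> t) * indicator {c..d} t) \<le> \<rho> (\<beta> t) * indicator {a..b} t"
      by (meson mult_left_mono order_trans zero_le)
  qed simp
  finally show "(\<Sum>(c, d)\<in>I. line_integral \<rho> (the \<circ> g) c d) \<le> ennreal L * (\<integral>\<^sup>+t\<in>{a..b}. \<rho> (\<beta> t) \<partial>lborel)" .
qed

section \<open>Two-segment paths through a point\<close>

text \<open>Later applied to the contraction
  \<open>z \<mapsto> (1 - s) *\<^sub>R c + s *\<^sub>R z\<close>, whose Jacobian supplies the factor
  \<open>1 / s ^ n\<close>.\<close>

lemma nn_integral_lborel_affine:
  fixes f :: "'a::euclidean_space \<Rightarrow> ennreal"
  assumes [measurable]: "f \<in> borel_measurable borel" and c: "0 < c"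
  shows "(\<integral>\<^sup>+ x. f (t + c *\<^sub>R x) \<partial>lborel) = ennreal (1 / c ^ DIM('a)) * (\<integral>\<^sup>+ x. f x \<partial>lborel)"
proof -
  have "(\<integral>\<^sup>+ x. f x \<partial>lborel)
      = (\<integral>\<^sup>+ x. f x \<partial>density (distr lborel borel (\<lambda>x. t + c *\<^sub>R x)) (\<lambda>_. \<bar>c\<bar> ^ DIM('a)))"
    using lborel_affine[of c t] c by simp
  also have "\<dots> = ennreal (c ^ DIM('a)) * (\<integral>\<^sup>+ x. f (t + c *\<^sub>R x) \<partial>lborel)"
    using c by (simp add: nn_integral_density nn_integral_distr nn_integral_cmult)
  finally show ?thesis
    using c by (simp add: mult.assoc[symmetric] ennreal_mult[symmetric])
qed

text \<open>A pointwise substitute for Hoelder's inequality.\<close>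
lemma le_add_power_div:
  fixes x :: ennreal
  assumes "0 < \<kappa>" "0 < n"
  shows "x \<le> ennreal \<kappa> + ennreal (1 / \<kappa> ^ (n - 1)) * x ^ n"
proof (cases x)
  case (real y)
  obtain m where n: "n = Suc m" using assms(2) gr0_implies_Suc by blast
  have "y \<le> \<kappa> + 1 / \<kappa> ^ (n - 1) * y ^ n"
  proof (cases "y \<le> \<kappa>")
    case True then show ?thesis using assms real by (simp add: add_increasing2)
  next
    case False
    then have "\<kappa> ^ m \<le> y ^ m" using assms by (intro power_mono) auto
    then have "1 \<le> 1 / \<kappa> ^ m * y ^ m" using assms by (simp add: field_simps)
    then have "y * 1 \<le> y * (1 / \<kappa> ^ m * y ^ m)" using real by (intro mult_left_mono) auto
    then show ?thesis using assms n by (simp add: mult_ac add_increasing)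
  qed
  then have "ennreal y \<le> ennreal (\<kappa> + 1 / \<kappa> ^ (n - 1) * y ^ n)" by (rule ennreal_leI)
  also have "\<dots> = ennreal \<kappa> + ennreal (1 / \<kappa> ^ (n - 1)) * ennreal y ^ n"
    using assms real by (subst ennreal_plus) (auto simp: ennreal_mult[symmetric] ennreal_power)
  finally show ?thesis using real by simp
next
  case top
  then show ?thesis using assms by (simp add: ennreal_mult_top ennreal_top_mult power_0_left top_power_ennreal)
qed

lemma half_le_of_one_le_add:
  fixes x :: ennreal
  assumes "1 \<le> ennreal (1/2) + x"
  shows "ennreal (1/2) \<le> x"
proof (cases x)
  case (real r)
  then have "ennreal 1 \<le> ennreal (1/2 + r)" using assms by (subst ennreal_plus) auto
  then have "1/2 \<le> r" using real by (subst (asm) ennreal_le_iff) auto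
  then show ?thesis using real by (simp add: ennreal_leI del: ennreal_half)
qed simp

text \<open>The first bound holds because the segment point is at distance
  \<open>s * norm (z - a)\<close> from \<open>a\<close>. For the second, \<open>a\<close> has
  nonnegative and \<open>z\<close> has at least \<open>t\<close> as component along
  \<open>v\<close>, so the segment point has component at least \<open>s * t\<close>.\<close>

lemma segment_point_bounds:
  fixes a v z :: "'a::real_inner"
  assumes a: "norm a = t" "0 \<le> a \<bullet> v" and v: "norm v = 1" and z: "norm (z - (2 * t) *\<^sub>R v) \<le> t"
    and s: "0 \<le> s" "s \<le> 1"
  shows "\<bar>norm ((1 - s) *\<^sub>R a + s *\<^sub>R z) - t\<bar> \<le> 4 * t * s"
    and "t / 8 \<le> norm ((1 - s) *\<^sub>R a + s *\<^sub>R z)"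
proof -
  let ?w = "(1 - s) *\<^sub>R a + s *\<^sub>R z"
  have t0: "0 \<le> t" using a by auto
  have nz: "norm z \<le> 3 * t"
    using norm_triangle_ineq[of "z - (2 * t) *\<^sub>R v" "(2 * t) *\<^sub>R v"] z v t0 by simp
  have "?w - a = s *\<^sub>R (z - a)" by (simp add: algebra_simps)
  then have "norm (?w - a) = s * norm (z - a)" using s by simp
  also have "norm (z - a) \<le> 4 * t" using norm_triangle_ineq4[of z a] nz a by simp
  then have "s * norm (z - a) \<le> s * (4 * t)" using s by (intro mult_left_mono) auto
  finally have wa: "norm (?w - a) \<le> 4 * t * s" by (simp add: mult_ac)
  show 1: "\<bar>norm ?w - t\<bar> \<le> 4 * t * s"
    using norm_triangle_ineq3[of ?w a] wa a by simp
  show "t / 8 \<le> norm ?w"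
  \<comment> \<open>Up to \<open>s = 1/8\<close> the first bound leaves a norm of at least
    \<open>t / 2\<close>; beyond it the component along \<open>v\<close> is at least
    \<open>t / 8\<close>.\<close>
  proof (cases "s \<le> 1/8")
    case True
    then have "4 * t * s \<le> 4 * t * (1/8)" using t0 by (intro mult_left_mono) auto
    then show ?thesis using 1 t0 by linarith
  next
    case False
    have "\<bar>(z - (2 * t) *\<^sub>R v) \<bullet> v\<bar> \<le> t"
      using Cauchy_Schwarz_ineq2[of "z - (2 * t) *\<^sub>R v" v] z v by simp
    moreover have "v \<bullet> v = 1" using v by (simp add: dot_square_norm)
    ultimately have "t \<le> z \<bullet> v" by (simp add: inner_diff_left)
    then have "s * t \<le> s * (z \<bullet> v)" using s by (intro mult_left_mono) auto
    also have "\<dots> \<le> ?w \<bullet> v" using a s by (simp add: inner_add_left)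
    also have "\<dots> \<le> norm ?w" using norm_cauchy_schwarz[of ?w v] v by simp
    finally have "s * t \<le> norm ?w" .
    moreover have "t / 8 \<le> s * t" using False t0 mult_right_mono[of "1/8" s t] by simp
    ultimately show ?thesis by linarith
  qed
qed

text \<open>By Cauchy-Schwarz and equality of the norms, \<open>a + b\<close> points into both
  half-spaces. For antipodal vectors any orthogonal direction serves, which is where dimension at
  least 2 enters.\<close>

lemma exists_unit_common_halfspace:
  fixes a b :: "'a::euclidean_space"
  assumes "2 \<le> DIM('a)" "norm a = norm b"
  shows "\<exists>v. norm v = 1 \<and> 0 \<le> a \<bullet> v \<and> 0 \<le> b \<bullet> v"
proof (cases "a + b = 0")
  case True
  obtain y where y: "y \<noteq> 0" "orthogonal a y"
    using orthogonal_to_vector_exists[OF assms(1)] by blast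
  have "b = - a" using True by (simp add: eq_neg_iff_add_eq_0 add.commute)
  then show ?thesis using y
    by (intro exI[of _ "y /\<^sub>R norm y"]) (simp add: orthogonal_def)
next
  case False
  have "\<bar>a \<bullet> b\<bar> \<le> (norm a)\<^sup>2" using Cauchy_Schwarz_ineq2[of a b] assms by (simp add: power2_eq_square)
  moreover have "a \<bullet> a = (norm a)\<^sup>2" "b \<bullet> b = (norm a)\<^sup>2" using assms by (simp_all add: dot_square_norm)
  ultimately have "0 \<le> a \<bullet> (a + b)" "0 \<le> b \<bullet> (a + b)"
    by (simp_all add: inner_add_right inner_commute)
  then show ?thesis using False
    by (intro exI[of _ "(a + b) /\<^sub>R norm (a + b)"]) (simp add: inner_scaleR_right)
qed

lemma nn_integral_powr_0_1:
  assumes "-1 < e"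
  shows "(\<integral>\<^sup>+s\<in>{0<..1}. ennreal (s powr e) \<partial>lborel) = ennreal (1 / (e + 1))"
proof -
  have "((\<lambda>x. x powr e) has_integral (1 powr (e+1) / (e+1))) {0..1}"
    using has_integral_powr_from_0[OF assms, of 1] by simp
  from nn_integral_has_integral_lebesgue[OF _ this]
  have "(\<integral>\<^sup>+s. ennreal (indicator {0..1} s * s powr e) \<partial>lborel) = ennreal (1 / (e + 1))" by simp
  moreover have "(\<integral>\<^sup>+s\<in>{0<..1}. ennreal (s powr e) \<partial>lborel)
      = (\<integral>\<^sup>+s. ennreal (indicator {0..1} s * s powr e) \<partial>lborel)"
    by (intro nn_integral_cong) (auto simp: indicator_def)
  ultimately show ?thesis by simp
qed

text \<open>Splitting \<open>\<rho>\<close> by \<open>le_add_power_div\<close> with a threshold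
  depending on \<open>s\<close> turns the line integrals into integrals of \<open>\<rho> ^ n\<close>
  at the cost of a constant 1/2. Averaging over a ball of points \<open>z\<close> and substituting
  the segment point \<open>w\<close> gives a volume integral in which \<open>a\<close> and
  \<open>b\<close> no longer occur.\<close>

lemma two_segment_estimate:
  fixes \<rho> :: "'a::euclidean_space \<Rightarrow> ennreal" and n :: nat and K :: real
  defines "n \<equiv> DIM('a)" and "K \<equiv> 4 * (8 * (real DIM('a) - 1)) ^ (DIM('a) - 1) * 4 ^ DIM('a)"
  assumes n: "2 \<le> n" and [measurable]: "\<rho> \<in> borel_measurable borel" and t: "0 < t"
    and ab: "dist p a = t" "dist p b = t"
    and adm: "\<And>z. dist p z \<le> 3 * t \<Longrightarrow> 1 \<le> ennreal (4 * t) *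
      (\<integral>\<^sup>+s\<in>{0<..1}. (\<rho> ((1 - s) *\<^sub>R a + s *\<^sub>R z) + \<rho> ((1 - s) *\<^sub>R b + s *\<^sub>R z)) \<partial>lborel)"
  shows "emeasure lborel (ball (0::'a) 1) \<le> ennreal K *
    (\<integral>\<^sup>+s\<in>{0<..1}. ennreal (s powr (-3/2)) * (\<integral>\<^sup>+w. \<rho> w ^ n *
        (if \<bar>dist p w - t\<bar> \<le> 4 * t * s \<and> t / 8 \<le> dist p w then 1 else 0) \<partial>lborel) \<partial>lborel)"
proof -
  \<comment> \<open>Any \<open>\<beta> < 1\<close> makes the error term integrable; this one turns the potential kernel into \<open>s\<^sup>-\<^sup>3\<^sup>/\<^sup>2\<close>,
    which is still integrable against the factor \<open>s\<close> coming from the integration over \<open>t\<close>.\<close>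
  define \<beta> where "\<beta> = 1 - 1 / (2 * (real n - 1))"
  \<comment> \<open>Chosen so that \<open>\<epsilon> / (1 - \<beta>) = 1/4\<close>: the two segments
    together lose exactly 1/2.\<close>
  define \<epsilon> where "\<epsilon> = 1 / (8 * (real n - 1))"
  have n1: "real n - 1 \<ge> 1" using n by simp
  have \<epsilon>0: "0 < \<epsilon>" using n1 by (simp add: \<epsilon>_def)
  define K0 where "K0 = 1 / \<epsilon> ^ (n - 1)"
  have K0: "0 < K0" "K = 4 * K0 * 4 ^ n" using \<epsilon>0 by (simp_all add: K0_def K_def \<epsilon>_def n_def power_one_over)
  define \<psi> where "\<psi> s w = (if \<bar>dist p w - t\<bar> \<le> 4 * t * s \<and> t / 8 \<le> dist p w then 1 else (0 :: ennreal))" for s w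
  have [measurable]: "(\<lambda>x. \<psi> (fst x) (snd x)) \<in> borel_measurable (borel \<Otimes>\<^sub>M borel)"
    unfolding \<psi>_def by measurable
  have [measurable]: "\<psi> s \<in> borel_measurable borel" for s
    unfolding \<psi>_def by measurable
  define h where "h w = \<rho> w ^ n" for w
  have [measurable]: "h \<in> borel_measurable borel" unfolding h_def by measurable
  obtain v where v: "norm v = 1" "0 \<le> (a - p) \<bullet> v" "0 \<le> (b - p) \<bullet> v"
    using exists_unit_common_halfspace[of "a - p" "b - p"] n ab
    by (auto simp: n_def dist_norm norm_minus_commute)
  \<comment> \<open>For \<open>z \<in> Z\<close> the segments from \<open>a\<close> and \<open>b\<close> to \<open>z\<close> stay at distance at least \<open>t/8\<close> from \<open>p\<close>.\<close>
  define Z where "Z = ball (p + (2 * t) *\<^sub>R v) t"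
  have Zb: "dist p z \<le> 3 * t" if "z \<in> Z" for z
  proof -
    have "dist p z \<le> dist p (p + (2 * t) *\<^sub>R v) + dist (p + (2 * t) *\<^sub>R v) z" by (rule dist_triangle)
    also have "dist p (p + (2 * t) *\<^sub>R v) = 2 * t" using v t by (simp add: dist_norm)
    finally show ?thesis using that by (simp add: Z_def)
  qed
  \<comment> \<open>The threshold is \<open>\<epsilon> * s powr (-\<beta>)\<close>; its power
    \<open>n - 1\<close> in the denominator produces the exponent
    \<open>\<beta> * (n - 1) = n - 3/2\<close>.\<close>
  have pw: "ennreal (4 * t) * \<rho> w \<le> ennreal (\<epsilon> * s powr (-\<beta>))
      + ennreal (K0 * (4 * t) ^ n) * (ennreal (s powr (real n - 3/2)) * h w)" if s: "0 < s" for w s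
  proof -
    have "(s powr \<beta>) ^ (n - 1) = s powr (\<beta> * (real n - 1))"
      using s n by (simp add: powr_power of_nat_diff mult.commute)
    also have "\<beta> * (real n - 1) = real n - 3/2" using n1 by (simp add: \<beta>_def field_simps)
    finally have "1 / (\<epsilon> * s powr (-\<beta>)) ^ (n - 1) = K0 * s powr (real n - 3/2)"
      using s \<epsilon>0 by (simp add: K0_def power_mult_distrib powr_minus power_inverse field_simps)
    moreover have "(ennreal (4 * t) * \<rho> w) ^ n = ennreal ((4 * t) ^ n) * h w"
      using t unfolding h_def power_mult_distrib by (subst ennreal_power) auto
    moreover have "ennreal (k * S) * (ennreal X * H) = ennreal (k * X) * (ennreal S * H)"
      if "0 \<le> k" "0 \<le> S" "0 \<le> X" for k S X :: real and H
      using that by (simp add: ennreal_mult mult_ac)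
    ultimately show ?thesis
      using le_add_power_div[of "\<epsilon> * s powr (-\<beta>)" n "ennreal (4 * t) * \<rho> w"] s \<epsilon>0 n t K0(1)
      by simp
  qed
  have mass: "(\<integral>\<^sup>+s\<in>{0<..1}. ennreal (\<epsilon> * s powr (-\<beta>)) \<partial>lborel) = ennreal (1 / 4)"
  proof -
    have "(\<integral>\<^sup>+s\<in>{0<..1}. ennreal (\<epsilon> * s powr (-\<beta>)) \<partial>lborel)
        = ennreal \<epsilon> * (\<integral>\<^sup>+s\<in>{0<..1}. ennreal (s powr (-\<beta>)) \<partial>lborel)"
      using \<epsilon>0 by (subst nn_integral_cmult[symmetric]) (auto simp: ennreal_mult mult_ac)
    also have "\<dots> = ennreal (\<epsilon> * (1 / (- \<beta> + 1)))"
      using \<epsilon>0 n1 by (subst nn_integral_powr_0_1) (auto simp: \<beta>_def ennreal_mult[symmetric] field_simps)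
    also have "\<epsilon> * (1 / (- \<beta> + 1)) = 1 / 4" using n1 by (simp add: \<beta>_def \<epsilon>_def field_simps)
    finally show ?thesis .
  qed
  have point: "ennreal (1 / 2) \<le> ennreal (K0 * (4 * t) ^ n) * (\<integral>\<^sup>+s\<in>{0<..1}. ennreal (s powr (real n - 3/2)) *
        (h ((1 - s) *\<^sub>R a + s *\<^sub>R z) + h ((1 - s) *\<^sub>R b + s *\<^sub>R z)) \<partial>lborel)" (is "_ \<le> _ * ?J z")
    if z: "z \<in> Z" for z
  proof -
    have "1 \<le> ennreal (4 * t) *
      (\<integral>\<^sup>+s\<in>{0<..1}. (\<rho> ((1 - s) *\<^sub>R a + s *\<^sub>R z) + \<rho> ((1 - s) *\<^sub>R b + s *\<^sub>R z)) \<partial>lborel)"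
      by (rule adm[OF Zb[OF z]])
    also have "\<dots> = (\<integral>\<^sup>+s\<in>{0<..1}. (ennreal (4 * t) * \<rho> ((1 - s) *\<^sub>R a + s *\<^sub>R z)
        + ennreal (4 * t) * \<rho> ((1 - s) *\<^sub>R b + s *\<^sub>R z)) \<partial>lborel)"
      by (subst nn_integral_cmult[symmetric]) (auto simp: algebra_simps)
    also have "\<dots> \<le> (\<integral>\<^sup>+s. ennreal (\<epsilon> * s powr (-\<beta>)) * indicator {0<..1} s
         + ennreal (\<epsilon> * s powr (-\<beta>)) * indicator {0<..1} s
         + ennreal (K0 * (4 * t) ^ n) * (ennreal (s powr (real n - 3/2)) *
        (h ((1 - s) *\<^sub>R a + s *\<^sub>R z) + h ((1 - s) *\<^sub>R b + s *\<^sub>R z)) * indicator {0<..1} s) \<partial>lborel)"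
    proof (rule nn_integral_mono)
      fix s
      show "(ennreal (4 * t) * \<rho> ((1 - s) *\<^sub>R a + s *\<^sub>R z)
        + ennreal (4 * t) * \<rho> ((1 - s) *\<^sub>R b + s *\<^sub>R z)) * indicator {0<..1} s
        \<le> ennreal (\<epsilon> * s powr (-\<beta>)) * indicator {0<..1} s
         + ennreal (\<epsilon> * s powr (-\<beta>)) * indicator {0<..1} s
         + ennreal (K0 * (4 * t) ^ n) * (ennreal (s powr (real n - 3/2)) *
        (h ((1 - s) *\<^sub>R a + s *\<^sub>R z) + h ((1 - s) *\<^sub>R b + s *\<^sub>R z)) * indicator {0<..1} s)"
        using add_mono[OF pw[of s "(1 - s) *\<^sub>R a + s *\<^sub>R z"] pw[of s "(1 - s) *\<^sub>R b + s *\<^sub>R z"]]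
        by (cases "s \<in> {0<..1}") (simp_all add: distrib_left add_ac)
    qed
    also have "\<dots> = ennreal (1/4) + ennreal (1/4) + ennreal (K0 * (4 * t) ^ n) * ?J z"
      by (simp add: nn_integral_add nn_integral_cmult mass)
    also have "ennreal (1/4) + ennreal (1/4) = ennreal (1/2)"
      by (subst ennreal_plus[symmetric]) auto
    finally have "1 \<le> ennreal (1/2) + ennreal (K0 * (4 * t) ^ n) * ?J z" .
    then show ?thesis by (rule half_le_of_one_le_add)
  qed
  \<comment> \<open>For \<open>z \<in> Z\<close> the segment point lies where
    \<open>\<psi> s\<close> is 1. Replacing the indicator of \<open>Z\<close> by
    \<open>\<psi> s\<close> before the change of variables removes the dependence on
    \<open>c\<close> and \<open>v\<close>.\<close>
  have slice: "(\<integral>\<^sup>+z. h ((1 - s) *\<^sub>R c + s *\<^sub>R z) * indicator Z z \<partial>lborel)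
      \<le> ennreal (1 / s ^ n) * (\<integral>\<^sup>+w. h w * \<psi> s w \<partial>lborel)"
    if s: "0 < s" "s \<le> 1" and c: "dist p c = t" "0 \<le> (c - p) \<bullet> v" for s c
  proof -
    have "(\<integral>\<^sup>+z. h ((1 - s) *\<^sub>R c + s *\<^sub>R z) * indicator Z z \<partial>lborel)
      \<le> (\<integral>\<^sup>+z. h ((1 - s) *\<^sub>R c + s *\<^sub>R z) * \<psi> s ((1 - s) *\<^sub>R c + s *\<^sub>R z) \<partial>lborel)"
    proof (intro nn_integral_mono mult_left_mono)
      fix z
      have "\<psi> s ((1 - s) *\<^sub>R c + s *\<^sub>R z) = 1" if "z \<in> Z"
      proof -
        have zz: "norm ((z - p) - (2 * t) *\<^sub>R v) \<le> t"
          using that by (simp add: Z_def dist_norm norm_minus_commute algebra_simps)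
        have cc: "norm (c - p) = t" using c by (simp add: dist_norm norm_minus_commute)
        have "((1 - s) *\<^sub>R (c - p) + s *\<^sub>R (z - p)) = ((1 - s) *\<^sub>R c + s *\<^sub>R z) - p"
          by (simp add: algebra_simps)
        then show ?thesis
          using segment_point_bounds[OF cc c(2) v(1) zz, of s] s
          by (simp add: \<psi>_def dist_norm norm_minus_commute)
      qed
      then show "indicator Z z \<le> \<psi> s ((1 - s) *\<^sub>R c + s *\<^sub>R z)" by (auto simp: indicator_def)
    qed simp
    also have "\<dots> = ennreal (1 / s ^ n) * (\<integral>\<^sup>+w. h w * \<psi> s w \<partial>lborel)"
      using nn_integral_lborel_affine[of "\<lambda>w. h w * \<psi> s w" s "(1 - s) *\<^sub>R c"] s by (simp add: n_def)
    finally show ?thesis .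
  qed
  have [measurable]: "Z \<in> sets borel" by (simp add: Z_def)
  have "ennreal (1 / 2) * (ennreal (t ^ n) * emeasure lborel (ball (0::'a) 1))
      = (\<integral>\<^sup>+z. ennreal (1 / 2) * indicator Z z \<partial>lborel)"
  proof -
    have "emeasure lborel Z = ennreal (t ^ n) * emeasure lborel (ball (0::'a) 1)"
      using t unit_ball_vol_nonneg by (simp add: Z_def emeasure_ball n_def ennreal_mult mult.commute)
    then show ?thesis by (simp add: nn_integral_cmult_indicator)
  qed
  also have "\<dots> \<le> (\<integral>\<^sup>+z. ennreal (K0 * (4 * t) ^ n) * (?J z * indicator Z z) \<partial>lborel)"
    using point by (intro nn_integral_mono) (auto simp: indicator_def)
  also have "\<dots> = ennreal (K0 * (4 * t) ^ n) * (\<integral>\<^sup>+z. ?J z * indicator Z z \<partial>lborel)"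
    by (rule nn_integral_cmult) measurable
  also have "(\<integral>\<^sup>+z. ?J z * indicator Z z \<partial>lborel)
     = (\<integral>\<^sup>+z. (\<integral>\<^sup>+s. (ennreal (s powr (real n - 3/2)) *
        (h ((1 - s) *\<^sub>R a + s *\<^sub>R z) + h ((1 - s) *\<^sub>R b + s *\<^sub>R z)) * indicator {0<..1} s)
          * indicator Z z \<partial>lborel) \<partial>lborel)"
    by (subst nn_integral_multc[symmetric]) auto
  also have "\<dots> = (\<integral>\<^sup>+s. (\<integral>\<^sup>+z. (ennreal (s powr (real n - 3/2)) *
        (h ((1 - s) *\<^sub>R a + s *\<^sub>R z) + h ((1 - s) *\<^sub>R b + s *\<^sub>R z)) * indicator {0<..1} s)
          * indicator Z z \<partial>lborel) \<partial>lborel)"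
    by (rule lborel_pair.Fubini') measurable
  \<comment> \<open>Both segments obey the same \<open>slice\<close> bound, whence the factor 2; the
    exponent is \<open>(n - 3/2) - n = -3/2\<close>.\<close>
  also have "\<dots> \<le> (\<integral>\<^sup>+s. 2 * (ennreal (s powr (-3/2)) * (\<integral>\<^sup>+w. h w * \<psi> s w \<partial>lborel) * indicator {0<..1} s) \<partial>lborel)"
  proof (rule nn_integral_mono)
    fix s :: real
    show "(\<integral>\<^sup>+z. (ennreal (s powr (real n - 3/2)) *
        (h ((1 - s) *\<^sub>R a + s *\<^sub>R z) + h ((1 - s) *\<^sub>R b + s *\<^sub>R z)) * indicator {0<..1} s)
          * indicator Z z \<partial>lborel)
      \<le> 2 * (ennreal (s powr (-3/2)) * (\<integral>\<^sup>+w. h w * \<psi> s w \<partial>lborel) * indicator {0<..1} s)"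
    proof (cases "s \<in> {0<..1}")
      case True
      then have s: "0 < s" "s \<le> 1" by auto
      define I where "I = (\<integral>\<^sup>+w. h w * \<psi> s w \<partial>lborel)"
      have "(\<integral>\<^sup>+z. (ennreal (s powr (real n - 3/2)) *
        (h ((1 - s) *\<^sub>R a + s *\<^sub>R z) + h ((1 - s) *\<^sub>R b + s *\<^sub>R z)) * indicator {0<..1} s)
          * indicator Z z \<partial>lborel)
        = ennreal (s powr (real n - 3/2)) * ((\<integral>\<^sup>+z. h ((1 - s) *\<^sub>R a + s *\<^sub>R z) * indicator Z z \<partial>lborel)
           + (\<integral>\<^sup>+z. h ((1 - s) *\<^sub>R b + s *\<^sub>R z) * indicator Z z \<partial>lborel))"
        using True
        by (subst nn_integral_add[symmetric], measurable, subst nn_integral_cmult[symmetric])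
           (auto simp: algebra_simps)
      also have "\<dots> \<le> ennreal (s powr (real n - 3/2)) * (ennreal (1 / s ^ n) * I + ennreal (1 / s ^ n) * I)"
        unfolding I_def using slice[OF s ab(1) v(2)] slice[OF s ab(2) v(3)]
        by (intro mult_left_mono add_mono) auto
      also have "\<dots> = 2 * ((ennreal (s powr (real n - 3/2)) * ennreal (1 / s ^ n)) * I)"
        by (simp add: mult_2 distrib_left mult_ac)
      also have "ennreal (s powr (real n - 3/2)) * ennreal (1 / s ^ n) = ennreal (s powr (-3/2))"
      proof -
        have "s powr (real n - 3/2) * (1 / s ^ n) = s powr (real n - 3/2) * s powr (- real n)"
          using s by (simp add: powr_minus_divide powr_realpow)
        also have "\<dots> = s powr (-3/2)" by (simp add: powr_add[symmetric])
        finally show ?thesis using s by (simp add: ennreal_mult[symmetric] del: times_divide_eq_right)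
      qed
      finally show ?thesis using True by (simp add: I_def)
    qed simp
  qed
  also have "\<dots> = 2 * (\<integral>\<^sup>+s\<in>{0<..1}. ennreal (s powr (-3/2)) * (\<integral>\<^sup>+w. h w * \<psi> s w \<partial>lborel) \<partial>lborel)"
    by (rule nn_integral_cmult) measurable
  finally have fin: "ennreal (1 / 2) * (ennreal (t ^ n) * emeasure lborel (ball (0::'a) 1))
    \<le> ennreal (K0 * (4 * t) ^ n) * (2 * (\<integral>\<^sup>+s\<in>{0<..1}. ennreal (s powr (-3/2)) * (\<integral>\<^sup>+w. h w * \<psi> s w \<partial>lborel) \<partial>lborel))"
    (is "_ * (_ * ?V) \<le> _ * (2 * ?S)") by (simp add: mult_left_mono)
  \<comment> \<open>The volume of \<open>Z\<close> and the factor \<open>(4 * t) ^ n\<close> both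
    scale like \<open>t ^ n\<close>, so the quotient is free of \<open>t\<close>.\<close>
  have "ennreal (2 / t ^ n) * (ennreal (1 / 2) * ennreal (t ^ n)) = ennreal (2 / t ^ n * (1 / 2 * t ^ n))"
    using t by (subst ennreal_mult, simp, simp, subst ennreal_mult) auto
  also have "2 / t ^ n * (1 / 2 * t ^ n) = 1" using t by simp
  finally have "?V = ennreal (2 / t ^ n) * (ennreal (1 / 2) * (ennreal (t ^ n) * ?V))"
    by (simp only: mult.assoc[symmetric] ennreal_1 mult_1_left)
  also have "\<dots> \<le> ennreal (2 / t ^ n) * (ennreal (K0 * (4 * t) ^ n) * (2 * ?S))"
    by (rule mult_left_mono[OF fin]) simp
  also have "\<dots> = (ennreal (2 / t ^ n) * (ennreal (K0 * (4 * t) ^ n) * ennreal 2)) * ?S"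
    by (simp add: mult_ac)
  also have "ennreal (2 / t ^ n) * (ennreal (K0 * (4 * t) ^ n) * ennreal 2) = ennreal (2 / t ^ n * (K0 * (4 * t) ^ n * 2))"
    using t K0(1) by (subst ennreal_mult, simp, simp, subst ennreal_mult) auto
  also have "2 / t ^ n * (K0 * (4 * t) ^ n * 2) = K"
    using t K0(2) by (simp add: power_mult_distrib mult_ac)
  finally show ?thesis by (simp add: h_def \<psi>_def)
qed

section \<open>The logarithmic lower bound\<close>

text \<open>The bound of \<open>two_segment_estimate\<close> is jointly measurable in
  \<open>t\<close>, \<open>s\<close> and \<open>w\<close>, so it can be integrated against
  \<open>dt / t\<close> and the order exchanged, although \<open>a\<close> and \<open>b\<close>
  depend arbitrarily on \<open>t\<close>. The inner integral over \<open>t\<close> is at most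
  \<open>320 * s\<close>, and the remaining \<open>s powr (-1/2)\<close> integrates to 2, whence
  640.\<close>

lemma crossing_log_estimate:
  fixes \<rho> :: "'a::euclidean_space \<Rightarrow> ennreal" and K :: real
  defines "K \<equiv> 4 * (8 * (real DIM('a) - 1)) ^ (DIM('a) - 1) * 4 ^ DIM('a)"
  assumes n: "2 \<le> DIM('a)" and [measurable]: "\<rho> \<in> borel_measurable borel"
    and t12: "0 < t1" "t1 \<le> t2"
    and adm: "\<And>t. t \<in> {t1..t2} \<Longrightarrow> \<exists>a b. dist p a = t \<and> dist p b = t \<and>
      (\<forall>z. dist p z \<le> 3 * t \<longrightarrow> 1 \<le> ennreal (4 * t) *
        (\<integral>\<^sup>+s\<in>{0<..1}. (\<rho> ((1 - s) *\<^sub>R a + s *\<^sub>R z) + \<rho> ((1 - s) *\<^sub>R b + s *\<^sub>R z)) \<partial>lborel))"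
  shows "emeasure lborel (ball (0::'a) 1) * ennreal (ln (t2 / t1))
    \<le> ennreal (640 * K) * (\<integral>\<^sup>+w. \<rho> w ^ DIM('a) \<partial>lborel)"
proof -
  let ?V = "emeasure lborel (ball (0::'a) 1)"
  define h where "h w = \<rho> w ^ DIM('a)" for w
  have [measurable]: "h \<in> borel_measurable borel" unfolding h_def by measurable
  have K: "0 \<le> K" using n by (simp add: K_def)
  define \<psi> where "\<psi> t s w = (if \<bar>dist p w - t\<bar> \<le> 4 * t * s \<and> t / 8 \<le> dist p w then 1 else (0 :: ennreal))" for t s w
  have [measurable]: "(\<lambda>x. \<psi> (f x) (g x) (k x)) \<in> borel_measurable M"
    if [measurable]: "f \<in> borel_measurable M" "g \<in> borel_measurable M" "k \<in> borel_measurable M"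
    for f g and k :: "_ \<Rightarrow> 'a" and M :: "'b measure"
    unfolding \<psi>_def by measurable
  define T where "T t = ennreal (1 / t) * indicator {t1..t2} t" for t
  define S where "S s = ennreal (s powr (-3/2)) * indicator {0<..1} s" for s :: real
  have [measurable]: "T \<in> borel_measurable borel" "S \<in> borel_measurable borel"
    unfolding T_def S_def by measurable
  have logint: "(\<integral>\<^sup>+t. T t \<partial>lborel) = ennreal (ln (t2 / t1))"
  proof -
    have "(\<integral>\<^sup>+t. T t \<partial>lborel) = ennreal (ln t2 - ln t1)"
      unfolding T_def using t12
      by (intro nn_integral_FTC_Icc) (auto intro!: derivative_eq_intros simp: has_real_derivative_iff_has_vector_derivative[symmetric])
    then show ?thesis using t12 by (simp add: ln_div)
  qed
  \<comment> \<open>With \<open>\<tau> = dist p w\<close>, each contributing \<open>t\<close>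
    satisfies \<open>t \<le> 8 * \<tau>\<close> and \<open>\<tau> \<le> 5 * t\<close>. Such
    \<open>t\<close> lie in an interval of length \<open>64 * \<tau> * s\<close>, and there
    \<open>1 / t \<le> 5 / \<tau>\<close>.\<close>
  have slice: "(\<integral>\<^sup>+t. T t * \<psi> t s w \<partial>lborel) \<le> ennreal (320 * s)" if s: "0 < s" "s \<le> 1" for s w
  proof -
    define \<tau> where "\<tau> = dist p w"
    define J where "J = {\<tau> - 32 * \<tau> * s .. \<tau> + 32 * \<tau> * s}"
    have "T t * \<psi> t s w \<le> ennreal (5 / \<tau>) * indicator J t" for t
    proof (cases "t \<in> {t1..t2} \<and> \<bar>\<tau> - t\<bar> \<le> 4 * t * s \<and> t / 8 \<le> \<tau>")
      case True
      then have t: "0 < t" "\<bar>\<tau> - t\<bar> \<le> 4 * t * s" "t \<le> 8 * \<tau>" using t12 by auto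
      then have \<tau>: "0 < \<tau>" by linarith
      have "4 * t * s \<le> 4 * t * 1" using t s by (intro mult_left_mono) auto
      then have "\<tau> \<le> 5 * t" using t by linarith
      then have "1 / t \<le> 5 / \<tau>" using t \<tau> by (simp add: field_simps)
      moreover have "4 * t * s \<le> 32 * \<tau> * s" using t s by (intro mult_right_mono) auto
      then have "\<bar>\<tau> - t\<bar> \<le> 32 * \<tau> * s" using t(2) by (rule order_trans[rotated])
      then have "t \<in> J" unfolding J_def atLeastAtMost_iff by linarith
      ultimately show ?thesis using True
        by (simp add: T_def \<psi>_def \<tau>_def ennreal_leI)
    next
      case False
      then show ?thesis by (auto simp: T_def \<psi>_def \<tau>_def)
    qed
    then have "(\<integral>\<^sup>+t. T t * \<psi> t s w \<partial>lborel) \<le> (\<integral>\<^sup>+t. ennreal (5 / \<tau>) * indicator J t \<partial>lborel)"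
      by (intro nn_integral_mono)
    also have "\<dots> = ennreal (5 / \<tau>) * emeasure lborel J"
      by (rule nn_integral_cmult_indicator) (simp add: J_def)
    also have "emeasure lborel J = ennreal (64 * \<tau> * s)"
      using s by (simp add: J_def \<tau>_def)
    also have "ennreal (5 / \<tau>) * ennreal (64 * \<tau> * s) = ennreal (5 / \<tau> * (64 * \<tau> * s))"
      using s by (subst ennreal_mult) (auto simp: \<tau>_def)
    also have "\<dots> \<le> ennreal (320 * s)" using s by (intro ennreal_leI) (cases "\<tau> = 0"; simp)
    finally show ?thesis .
  qed
  have "?V * ennreal (ln (t2 / t1)) = (\<integral>\<^sup>+t. ?V * T t \<partial>lborel)"
    by (simp add: nn_integral_cmult logint)
  also have "\<dots> \<le> (\<integral>\<^sup>+t. ennreal K * (\<integral>\<^sup>+s. (\<integral>\<^sup>+w. T t * S s * h w * \<psi> t s w \<partial>lborel) \<partial>lborel) \<partial>lborel)"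
  proof (rule nn_integral_mono)
    fix t :: real
    show "?V * T t \<le> ennreal K * (\<integral>\<^sup>+s. (\<integral>\<^sup>+w. T t * S s * h w * \<psi> t s w \<partial>lborel) \<partial>lborel)"
    proof (cases "t \<in> {t1..t2}")
      case True
      from adm[OF this] obtain a b where ab: "dist p a = t" "dist p b = t"
        "\<And>z. dist p z \<le> 3 * t \<Longrightarrow> 1 \<le> ennreal (4 * t) *
        (\<integral>\<^sup>+s\<in>{0<..1}. (\<rho> ((1 - s) *\<^sub>R a + s *\<^sub>R z) + \<rho> ((1 - s) *\<^sub>R b + s *\<^sub>R z)) \<partial>lborel)"
        by blast
      have "0 < t" using True t12 by auto
      from two_segment_estimate[OF n assms(3) this ab]
      have "?V \<le> ennreal K * (\<integral>\<^sup>+s\<in>{0<..1}. ennreal (s powr (-3/2)) * (\<integral>\<^sup>+w. h w * \<psi> t s w \<partial>lborel) \<partial>lborel)"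
        unfolding h_def \<psi>_def K_def by simp
      then have "?V * T t \<le> ennreal K * (\<integral>\<^sup>+s\<in>{0<..1}. ennreal (s powr (-3/2)) * (\<integral>\<^sup>+w. h w * \<psi> t s w \<partial>lborel) \<partial>lborel) * T t"
        by (rule mult_right_mono) simp
      also have "\<dots> = ennreal K * (T t * (\<integral>\<^sup>+s. S s * (\<integral>\<^sup>+w. h w * \<psi> t s w \<partial>lborel) \<partial>lborel))"
        unfolding S_def by (simp add: mult_ac)
      also have "\<dots> = ennreal K * (\<integral>\<^sup>+s. (\<integral>\<^sup>+w. T t * S s * h w * \<psi> t s w \<partial>lborel) \<partial>lborel)"
        by (simp add: nn_integral_cmult[symmetric] mult.assoc)
      finally show ?thesis .
    qed (simp add: T_def)
  qed
  also have "\<dots> = ennreal K * (\<integral>\<^sup>+t. (\<integral>\<^sup>+s. (\<integral>\<^sup>+w. T t * S s * h w * \<psi> t s w \<partial>lborel) \<partial>lborel) \<partial>lborel)"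
    by (rule nn_integral_cmult) measurable
  also have "(\<integral>\<^sup>+t. (\<integral>\<^sup>+s. (\<integral>\<^sup>+w. T t * S s * h w * \<psi> t s w \<partial>lborel) \<partial>lborel) \<partial>lborel)
      = (\<integral>\<^sup>+s. (\<integral>\<^sup>+t. (\<integral>\<^sup>+w. T t * S s * h w * \<psi> t s w \<partial>lborel) \<partial>lborel) \<partial>lborel)"
    by (rule lborel_pair.Fubini') measurable
  also have "\<dots> = (\<integral>\<^sup>+s. (\<integral>\<^sup>+w. (\<integral>\<^sup>+t. T t * S s * h w * \<psi> t s w \<partial>lborel) \<partial>lborel) \<partial>lborel)"
    by (intro nn_integral_cong lborel_pair.Fubini') measurable
  also have "\<dots> \<le> (\<integral>\<^sup>+s. (\<integral>\<^sup>+w. (ennreal 320 * (ennreal (s powr (-1/2)) * indicator {0<..1} s)) * h w \<partial>lborel) \<partial>lborel)"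
  proof (intro nn_integral_mono)
    fix s :: real and w
    show "(\<integral>\<^sup>+t. T t * S s * h w * \<psi> t s w \<partial>lborel) \<le> (ennreal 320 * (ennreal (s powr (-1/2)) * indicator {0<..1} s)) * h w"
    proof (cases "s \<in> {0<..1}")
      case True
      then have s: "0 < s" "s \<le> 1" by auto
      have "(\<integral>\<^sup>+t. T t * S s * h w * \<psi> t s w \<partial>lborel) = (\<integral>\<^sup>+t. (S s * h w) * (T t * \<psi> t s w) \<partial>lborel)"
        by (simp add: mult_ac)
      also have "\<dots> = (S s * h w) * (\<integral>\<^sup>+t. T t * \<psi> t s w \<partial>lborel)"
        by (rule nn_integral_cmult) measurable
      also have "\<dots> \<le> (S s * h w) * ennreal (320 * s)" by (rule mult_left_mono[OF slice[OF s]]) simp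
      also have "\<dots> = (ennreal (s powr (-3/2)) * ennreal (320 * s)) * h w"
        using True by (simp add: S_def mult_ac)
      also have "ennreal (s powr (-3/2)) * ennreal (320 * s) = ennreal (320 * (s powr (-3/2) * s powr 1))"
        using s by (subst ennreal_mult[symmetric]) (auto simp: mult_ac)
      also have "s powr (-3/2) * s powr 1 = s powr (-1/2)" unfolding powr_add[symmetric] by simp
      finally show ?thesis using True by (simp add: ennreal_mult)
    qed (simp add: S_def)
  qed
  also have "\<dots> = (\<integral>\<^sup>+s. (ennreal 320 * (ennreal (s powr (-1/2)) * indicator {0<..1} s)) * (\<integral>\<^sup>+w. h w \<partial>lborel) \<partial>lborel)"
    by (intro nn_integral_cong nn_integral_cmult) measurable
  also have "\<dots> = (ennreal 320 * (\<integral>\<^sup>+s\<in>{0<..1}. ennreal (s powr (-1/2)) \<partial>lborel)) * (\<integral>\<^sup>+w. h w \<partial>lborel)"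
    by (subst nn_integral_multc, measurable, subst nn_integral_cmult, measurable)
  also have "(\<integral>\<^sup>+s\<in>{0<..1}. ennreal (s powr (-1/2)) \<partial>lborel) = ennreal 2"
    by (subst nn_integral_powr_0_1) auto
  also have "ennreal 320 * ennreal 2 = ennreal 640" by (subst ennreal_mult[symmetric]) auto
  finally have "?V * ennreal (ln (t2 / t1)) \<le> ennreal K * (ennreal 640 * (\<integral>\<^sup>+w. h w \<partial>lborel))"
    by (simp add: mult_left_mono)
  also have "\<dots> = ennreal (640 * K) * (\<integral>\<^sup>+w. h w \<partial>lborel)"
    using K by (simp add: ennreal_mult mult_ac)
  finally show ?thesis by (simp add: h_def)
qed

section \<open>The chordal sphere and the modulus of a ring\<close>

text \<open>Stereographic projection onto the sphere of diameter 1 resting on the origin, with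
  infinity at the north pole \<open>(0, 1)\<close>. It makes the chordal metric a Euclidean
  distance, so that limits, continuity and compactness become those of
  \<open>'a \<times> real\<close>.\<close>

definition stereo :: "'a::euclidean_space option \<Rightarrow> 'a \<times> real" where
  "stereo u = (case u of None \<Rightarrow> (0, 1)
     | Some x \<Rightarrow> (x /\<^sub>R (1 + (norm x)\<^sup>2), (norm x)\<^sup>2 / (1 + (norm x)\<^sup>2)))"

lemma stereo_simps [simp]:
  "stereo None = (0, 1)"
  "stereo (Some x) = (x /\<^sub>R (1 + (norm x)\<^sup>2), (norm x)\<^sup>2 / (1 + (norm x)\<^sup>2))"
  by (simp_all add: stereo_def)

lemma one_plus_norm_sq_pos: "0 < 1 + (norm x)\<^sup>2"
  by (simp add: add_pos_nonneg)

text \<open>This is the equation of the sphere with centre \<open>(0, 1/2)\<close> and radius 1/2.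
  It reduces squared distances to the last coordinates and one inner product.\<close>

lemma inner_stereo_self: "stereo u \<bullet> stereo u = snd (stereo u)"
proof (cases u)
  case (Some x)
  define m where "m = 1 + (norm x)\<^sup>2"
  have m: "0 < m" "(norm x)\<^sup>2 = m - 1" using one_plus_norm_sq_pos[of x] by (simp_all add: m_def)
  have xx: "x \<bullet> x = m - 1" using m(2) by (simp add: power2_norm_eq_inner)
  have "stereo u \<bullet> stereo u = (m - 1) / (m * m) + ((m - 1) / m) * ((m - 1) / m)"
    using xx by (simp add: Some inner_Pair m_def[symmetric] m(2) divide_inverse mult_ac)
  also have "\<dots> = (m - 1) / m" using m by (simp add: field_simps)
  finally show ?thesis using m by (simp add: Some m_def[symmetric])
qed (simp add: inner_Pair)

lemma chordal_eq_dist: "chordal u v = dist (stereo u) (stereo v)"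
proof -
  have d: "(dist (stereo u) (stereo v))\<^sup>2 = snd (stereo u) + snd (stereo v) - 2 * (stereo u \<bullet> stereo v)"
    by (simp add: dist_norm power2_norm_eq_inner inner_diff_left inner_diff_right inner_stereo_self inner_commute
        del: stereo_simps)
  have "0 \<le> chordal u v"
    by (auto simp: chordal_def split: option.splits)
  moreover have "(chordal u v)\<^sup>2 = (dist (stereo u) (stereo v))\<^sup>2"
  proof (cases u; cases v)
    fix x y assume [simp]: "u = Some x" "v = Some y"
    define a b where "a = 1 + (norm x)\<^sup>2" and "b = 1 + (norm y)\<^sup>2"
    have ab: "0 < a" "0 < b" "(norm x)\<^sup>2 = a - 1" "(norm y)\<^sup>2 = b - 1"
      using one_plus_norm_sq_pos by (simp_all add: a_def b_def)
    have "(chordal u v)\<^sup>2 = (norm (x - y))\<^sup>2 / (a * b)"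
      using ab(1,2) by (simp add: chordal_def power_divide power_mult_distrib a_def[symmetric] b_def[symmetric])
    also have "(norm (x - y))\<^sup>2 = (a - 1) + (b - 1) - 2 * (x \<bullet> y)"
      unfolding ab(3,4)[symmetric] by (simp add: power2_norm_eq_inner inner_diff_left inner_diff_right inner_commute)
    also have "((a - 1) + (b - 1) - 2 * (x \<bullet> y)) / (a * b)
      = (a - 1) / a + (b - 1) / b - 2 * ((x \<bullet> y) / (a * b) + ((a - 1) / a) * ((b - 1) / b))"
      using ab(1,2) by (simp add: field_simps)
    also have "\<dots> = (dist (stereo u) (stereo v))\<^sup>2"
      unfolding d using ab(1,2)
      by (simp add: inner_Pair a_def[symmetric] b_def[symmetric] ab(3,4) divide_inverse)
    finally show ?thesis .
  next
    fix x assume [simp]: "u = Some x" "v = None"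
    show ?thesis unfolding d using one_plus_norm_sq_pos[of x]
      by (simp add: chordal_def power_divide inner_Pair field_simps)
  next
    fix x assume [simp]: "u = None" "v = Some x"
    show ?thesis unfolding d using one_plus_norm_sq_pos[of x]
      by (simp add: chordal_def power_divide inner_Pair field_simps)
  next
    assume [simp]: "u = None" "v = None"
    show ?thesis by (simp add: chordal_def)
  qed
  ultimately show ?thesis by simp
qed

lemma chordal_Some_le: "chordal (Some x) (Some y) \<le> dist x y"
proof -
  have "1 * 1 \<le> sqrt (1 + (norm x)\<^sup>2) * sqrt (1 + (norm y)\<^sup>2)" by (intro mult_mono) auto
  then have "norm (x - y) / (sqrt (1 + (norm x)\<^sup>2) * sqrt (1 + (norm y)\<^sup>2)) \<le> norm (x - y) / 1"
    by (intro divide_left_mono) auto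
  then show ?thesis by (simp add: chordal_def dist_norm)
qed

lemma stereo_eq_infinity_iff: "stereo u = (0, 1) \<longleftrightarrow> u = None"
proof (cases u)
  case (Some x)
  have "(norm x)\<^sup>2 / (1 + (norm x)\<^sup>2) \<noteq> 1" using one_plus_norm_sq_pos[of x] by (simp add: field_simps)
  then show ?thesis using Some by simp
qed simp

text \<open>The inverse projection; it carries continuity and injectivity back to finite
  points.\<close>

lemma the_eq_stereo: "u \<noteq> None \<Longrightarrow> the u = fst (stereo u) /\<^sub>R (1 - snd (stereo u))"
proof -
  assume "u \<noteq> None"
  then obtain x where x: "u = Some x" by auto
  have "1 - (norm x)\<^sup>2 / (1 + (norm x)\<^sup>2) = 1 / (1 + (norm x)\<^sup>2)"
    using one_plus_norm_sq_pos[of x] by (simp add: field_simps)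
  then show ?thesis using x one_plus_norm_sq_pos[of x] by simp
qed

lemma stereo_inj: "stereo u = stereo v \<Longrightarrow> u = v"
  by (metis stereo_eq_infinity_iff the_eq_stereo option.expand)

lemma snd_stereo_less: "u \<noteq> None \<Longrightarrow> snd (stereo u) < 1"
proof -
  assume "u \<noteq> None"
  then obtain x where "u = Some x" by auto
  then show ?thesis using one_plus_norm_sq_pos[of x] by simp
qed

lemma continuous_on_stereo_Some: "continuous_on UNIV (\<lambda>x. stereo (Some x))"
  unfolding continuous_on_iff chordal_eq_dist[symmetric]
  by (meson chordal_Some_le le_less_trans)

lemma chordal_continuous_on_iff: "chordal_continuous_on D f \<longleftrightarrow> continuous_on D (\<lambda>x. stereo (f x))"
  by (simp add: chordal_continuous_on_def chordal_eq_dist continuous_on_iff)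

lemma continuous_on_the_stereo:
  assumes "continuous_on A (\<lambda>x. stereo (f x))" "\<And>x. x \<in> A \<Longrightarrow> f x \<noteq> None"
  shows "continuous_on A (\<lambda>x. the (f x))"
proof -
  have "continuous_on A (\<lambda>x. fst (stereo (f x)) /\<^sub>R (1 - snd (stereo (f x))))"
    using assms(1) snd_stereo_less[OF assms(2)] by (intro continuous_intros) force+
  then show ?thesis by (rule continuous_on_eq) (metis assms(2) the_eq_stereo)
qed

text \<open>Under stereographic projection the Euclidean sphere \<open>S(p,t)\<close> is a hyperplane section; this is
  the affine function cutting it out, negative on the side of \<open>p\<close> and positive on the side of \<open>\<infinity>\<close>.\<close>
definition sphere_side :: "'a::euclidean_space \<Rightarrow> real \<Rightarrow> 'a \<times> real \<Rightarrow> real" where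
  "sphere_side p t y = snd y - 2 * (fst y \<bullet> p) + (1 - snd y) * ((norm p)\<^sup>2 - t\<^sup>2)"

lemma sphere_side_stereo_None [simp]: "sphere_side p t (stereo None) = 1"
  by (simp add: sphere_side_def)

lemma sphere_side_stereo_Some:
  "sphere_side p t (stereo (Some w)) = ((dist p w)\<^sup>2 - t\<^sup>2) / (1 + (norm w)\<^sup>2)"
proof -
  define m where "m = 1 + (norm w)\<^sup>2"
  have m: "0 < m" "(norm w)\<^sup>2 = m - 1" using one_plus_norm_sq_pos[of w] by (simp_all add: m_def)
  have dpw: "(dist p w)\<^sup>2 = (m - 1) - 2 * (w \<bullet> p) + (norm p)\<^sup>2"
    unfolding m(2)[symmetric]
    by (simp add: dist_norm power2_norm_eq_inner inner_diff_left inner_diff_right inner_commute)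
  have "sphere_side p t (stereo (Some w))
      = (m - 1) / m - 2 * ((w \<bullet> p) / m) + (1 - (m - 1) / m) * ((norm p)\<^sup>2 - t\<^sup>2)"
    by (simp add: sphere_side_def m_def[symmetric] m(2) divide_inverse mult_ac)
  also have "\<dots> = ((m - 1) - 2 * (w \<bullet> p) + (norm p)\<^sup>2 - t\<^sup>2) / m"
    using m(1) by (simp add: field_simps)
  finally show ?thesis using dpw by (simp add: m_def)
qed

lemma sphere_side_neg_iff: "0 \<le> t \<Longrightarrow> sphere_side p t (stereo u) < 0 \<longleftrightarrow> (\<exists>w. u = Some w \<and> dist p w < t)"
proof (cases u)
  case (Some w)
  assume "0 \<le> t"
  then have "(dist p w)\<^sup>2 < t\<^sup>2 \<longleftrightarrow> dist p w < t" by (metis power_mono_iff not_le pos2 zero_le_dist)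
  then show ?thesis using one_plus_norm_sq_pos[of w]
    by (simp add: Some sphere_side_stereo_Some divide_less_0_iff del: stereo_simps)
qed (simp add: sphere_side_def)

lemma sphere_side_pos_iff: "0 \<le> t \<Longrightarrow> sphere_side p t (stereo u) > 0 \<longleftrightarrow> (\<forall>w. u = Some w \<longrightarrow> t < dist p w)"
proof (cases u)
  case (Some w)
  assume "0 \<le> t"
  then have "t\<^sup>2 < (dist p w)\<^sup>2 \<longleftrightarrow> t < dist p w" by (metis power_mono_iff not_le pos2 zero_le_dist)
  then show ?thesis using one_plus_norm_sq_pos[of w]
    by (simp add: Some sphere_side_stereo_Some zero_less_divide_iff del: stereo_simps)
qed (simp add: sphere_side_def)

lemma continuous_on_sphere_side: "continuous_on S (sphere_side p t)"
  unfolding sphere_side_def by (intro continuous_intros)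

text \<open>Inside the sphere of radius \<open>t1\<close> is inside that of radius \<open>t\<close>,
  and likewise for outside and \<open>t2\<close>, so \<open>sphere_side p t\<close> changes sign on
  the image. The image may pass through infinity, where \<open>sphere_side\<close> equals 1, so a
  zero is a finite point of the sphere.\<close>

lemma connected_crosses_sphere:
  assumes "connected S" "continuous_on S (\<lambda>x. stereo (F x))" "0 < t1" "t1 \<le> t" "t \<le> t2"
    and "y \<in> S" "sphere_side p t1 (stereo (F y)) < 0"
    and "y' \<in> S" "0 < sphere_side p t2 (stereo (F y'))"
  shows "\<exists>a. dist p a = t \<and> Some a \<in> F ` S"
proof -
  have "continuous_on S (\<lambda>x. sphere_side p t (stereo (F x)))"
    using continuous_on_compose2[OF continuous_on_sphere_side assms(2)] by blast
  then have "connected ((\<lambda>x. sphere_side p t (stereo (F x))) ` S)"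
    using assms(1) connected_continuous_image by blast
  moreover have "sphere_side p t (stereo (F y)) < 0"
    using assms by (auto simp: sphere_side_neg_iff simp del: stereo_simps)
  moreover have "0 < sphere_side p t (stereo (F y'))"
    using assms by (auto simp: sphere_side_pos_iff simp del: stereo_simps)
  ultimately obtain x where x: "x \<in> S" "sphere_side p t (stereo (F x)) = 0"
    using connectedD_interval[of "(\<lambda>x. sphere_side p t (stereo (F x))) ` S"
        "sphere_side p t (stereo (F y))" "sphere_side p t (stereo (F y'))" 0] assms(6,8)
    by force
  then obtain w where w: "F x = Some w"
    by (cases "F x") (auto simp del: stereo_simps)
  with x(2) have "(dist p w)\<^sup>2 = t\<^sup>2"
    using one_plus_norm_sq_pos[of w] by (simp add: sphere_side_stereo_Some del: stereo_simps)
  then have "dist p w = t" using assms(3,4) by (simp add: power2_eq_iff_nonneg)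
  then show ?thesis using x(1) w by (metis imageI)
qed

section \<open>Lifting Euclidean paths through the ring and bounding its modulus from below\<close>

lemma chordal_homeo_intoD:
  assumes "chordal_homeo_into D F"
  shows "inj_on F D" "continuous_on D (\<lambda>x. stereo (F x))"
    "\<And>x e. x \<in> D \<Longrightarrow> 0 < e \<Longrightarrow> \<exists>d>0. \<forall>y\<in>D. dist (stereo (F y)) (stereo (F x)) < d \<longrightarrow> dist y x < e"
  using assms by (auto simp: chordal_homeo_into_def chordal_continuous_on_iff chordal_eq_dist)

text \<open>The points sent to infinity form a relatively closed set. On the open remainder the
  finite part of \<open>F\<close> is continuous and injective, so invariance of domain
  applies.\<close>

lemma open_finite_part_image:
  fixes F :: "'a::euclidean_space \<Rightarrow> 'a option"
  assumes "open U" "inj_on F U" "continuous_on U (\<lambda>x. stereo (F x))"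
  shows "open {w. Some w \<in> F ` U}"
proof -
  define A where "A = U \<inter> (\<lambda>x. stereo (F x)) -` (- {(0, 1)})"
  have "open A" unfolding A_def using assms by (intro continuous_open_preimage) auto
  have A: "x \<in> A \<longleftrightarrow> x \<in> U \<and> F x \<noteq> None" for x by (simp add: A_def stereo_eq_infinity_iff)
  have "continuous_on A (\<lambda>x. the (F x))"
    using A assms(3) by (intro continuous_on_the_stereo) (auto intro: continuous_on_subset)
  moreover have "inj_on (\<lambda>x. the (F x)) A"
    using assms(2) A by (auto simp: inj_on_def)
  ultimately have "open ((\<lambda>x. the (F x)) ` A)" using \<open>open A\<close> by (intro invariance_of_domain)
  moreover have "(\<lambda>x. the (F x)) ` A = {w. Some w \<in> F ` U}"
    using A by (force simp: image_iff)
  ultimately show ?thesis by simp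
qed

text \<open>The path \<open>\<beta>\<close> may leave the image of \<open>D\<close>, but until its
  first exit from the image of \<open>ball x0 r2\<close> it can be pulled back by \<open>F\<close>.
  The pullback runs from \<open>cball x0 r1\<close> to the outer sphere, hence meets the inner
  one.\<close>

lemma lift_path_through_ring:
  fixes F :: "'a::euclidean_space \<Rightarrow> 'a option" and \<beta> :: "real \<Rightarrow> 'a"
  assumes F: "chordal_homeo_into D F" and D: "cball x0 r2 \<subseteq> D" and r: "0 < r1" "r1 < r2"
    and \<beta>: "continuous_on UNIV \<beta>" and u: "u0 \<le> u1"
    and start: "Some (\<beta> u0) \<in> F ` cball x0 r1" and stop: "Some (\<beta> u1) \<in> F ` (D - ball x0 r2)"
  shows "\<exists>s1 s2 \<alpha>. u0 \<le> s1 \<and> s2 \<le> u1 \<and> (s1, s2, \<alpha>) \<in> path_family (sphere x0 r1) (sphere x0 r2) D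
    \<and> (\<forall>t\<in>{s1..s2}. F (\<alpha> t) = Some (\<beta> t))"
proof -
  note inj = chordal_homeo_intoD(1)[OF F] and cont = chordal_homeo_intoD(2)[OF F]
  have bD: "ball x0 r2 \<subseteq> D" using D ball_subset_cball by blast
  define V where "V = {w. Some w \<in> F ` ball x0 r2}"
  have "open V" unfolding V_def using inj cont bD
    by (intro open_finite_part_image) (auto intro: inj_on_subset continuous_on_subset)
  \<comment> \<open>The times at which \<open>\<beta>\<close> is outside the image of the open ball.
    Openness of \<open>V\<close> makes \<open>T\<close> compact, so there is a first such time;
    injectivity of \<open>F\<close> puts \<open>u1\<close> into \<open>T\<close>.\<close>
  define T where "T = {u0..u1} \<inter> \<beta> -` (- V)"
  have "compact T" unfolding T_def using \<open>open V\<close> \<beta>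
    by (intro compact_Int_closed closed_vimage) auto
  obtain y1 where y1: "y1 \<in> D" "y1 \<notin> ball x0 r2" "F y1 = Some (\<beta> u1)" using stop by force
  have "\<beta> u1 \<notin> V"
  proof
    assume "\<beta> u1 \<in> V"
    then obtain y where "y \<in> ball x0 r2" "F y = Some (\<beta> u1)" by (auto simp: V_def)
    then show False using y1 inj_onD[OF inj, of y y1] bD by auto
  qed
  then have "u1 \<in> T" using u by (simp add: T_def)
  then obtain s2 where s2: "s2 \<in> T" "\<And>u. u \<in> T \<Longrightarrow> s2 \<le> u"
    using compact_attains_inf[OF \<open>compact T\<close>] by blast
  define \<alpha> where "\<alpha> u = inv_into D F (Some (\<beta> u))" for u
  have \<alpha>: "\<alpha> u = x" if "x \<in> D" "F x = Some (\<beta> u)" for u x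
    using that inj unfolding \<alpha>_def by (metis inv_into_f_f)
  obtain y0 where y0: "y0 \<in> cball x0 r1" "F y0 = Some (\<beta> u0)" using start by force
  have "y0 \<in> ball x0 r2" using y0 r by auto
  then have "\<beta> u0 \<in> V" using y0 by (force simp: V_def)
  then have s2u: "u0 < s2" "s2 \<le> u1" using s2(1) by (auto simp: T_def order_le_less)
  have bef: "Some (\<beta> u) \<in> F ` ball x0 r2" if "u \<in> {u0..<s2}" for u
    using s2(2)[of u] that s2u by (force simp: T_def V_def)
  \<comment> \<open>At the exit time itself a preimage still exists, because the image of
    \<open>cball x0 r2\<close> is compact and hence closed.\<close>
  have all: "Some (\<beta> u) \<in> F ` cball x0 r2" if "u \<in> {u0..s2}" for u
  proof -
    have "compact ((\<lambda>x. stereo (F x)) ` cball x0 r2)"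
      using cont D by (intro compact_continuous_image) (auto intro: continuous_on_subset)
    then have "closed ((\<lambda>x. stereo (F x)) ` cball x0 r2)" by (rule compact_imp_closed)
    moreover have "(\<lambda>u. stereo (Some (\<beta> u))) ` {u0..<s2} \<subseteq> (\<lambda>x. stereo (F x)) ` cball x0 r2"
    proof (rule image_subsetI)
      fix u assume "u \<in> {u0..<s2}"
      from bef[OF this] obtain x where "x \<in> ball x0 r2" "F x = Some (\<beta> u)" by force
      then show "stereo (Some (\<beta> u)) \<in> (\<lambda>x. stereo (F x)) ` cball x0 r2"
        by (intro image_eqI[where x = x]) auto
    qed
    moreover have "continuous_on (closure {u0..<s2}) (\<lambda>u. stereo (Some (\<beta> u)))"
      using continuous_on_compose2[OF continuous_on_stereo_Some \<beta>] continuous_on_subset by blast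
    ultimately have "(\<lambda>u. stereo (Some (\<beta> u))) ` closure {u0..<s2} \<subseteq> (\<lambda>x. stereo (F x)) ` cball x0 r2"
      using image_closure_subset by blast
    moreover have "closure {u0..<s2} = {u0..s2}" using s2u by simp
    ultimately have "stereo (Some (\<beta> u)) \<in> (\<lambda>x. stereo (F x)) ` cball x0 r2" using that by blast
    then obtain x where "x \<in> cball x0 r2" "stereo (Some (\<beta> u)) = stereo (F x)" by (rule imageE)
    then show ?thesis using stereo_inj[of "Some (\<beta> u)" "F x"] by (intro image_eqI[where x = x]) auto
  qed
  have \<alpha>all: "\<alpha> u \<in> cball x0 r2 \<and> F (\<alpha> u) = Some (\<beta> u)" if "u \<in> {u0..s2}" for u
    using all[OF that] \<alpha> D by (metis (no_types, lifting) imageE subsetD)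
  have "\<alpha> s2 \<notin> ball x0 r2"
    using \<alpha>all[of s2] s2(1) s2u by (force simp: T_def V_def)
  then have \<alpha>s2: "dist x0 (\<alpha> s2) = r2" using \<alpha>all[of s2] s2u by auto
  have \<alpha>u0: "dist x0 (\<alpha> u0) \<le> r1" using \<alpha>[of y0 u0] y0 \<open>y0 \<in> ball x0 r2\<close> bD by auto
  \<comment> \<open>Continuity of the pullback comes from the inverse condition in
    \<open>chordal_homeo_into\<close>, since the chordal distance is at most the Euclidean
    one.\<close>
  have \<alpha>c: "continuous_on {u0..s2} \<alpha>"
    unfolding continuous_on_iff
  proof (intro ballI allI impI)
    fix u and e :: real assume u: "u \<in> {u0..s2}" and e: "0 < e"
    then have "\<alpha> u \<in> D" using \<alpha>all D by blast
    from chordal_homeo_intoD(3)[OF F this e] obtain d where d: "0 < d"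
      "\<And>y. y \<in> D \<Longrightarrow> dist (stereo (F y)) (stereo (F (\<alpha> u))) < d \<Longrightarrow> dist y (\<alpha> u) < e" by blast
    obtain k where k: "0 < k" "\<And>u'. dist u' u < k \<Longrightarrow> dist (\<beta> u') (\<beta> u) < d"
      using \<beta> d(1) unfolding continuous_on_iff by blast
    have "dist (\<alpha> u') (\<alpha> u) < e" if "u' \<in> {u0..s2}" "dist u' u < k" for u'
    proof (rule d(2))
      show "\<alpha> u' \<in> D" using \<alpha>all[OF that(1)] D by blast
      show "dist (stereo (F (\<alpha> u'))) (stereo (F (\<alpha> u))) < d"
        using \<alpha>all[OF that(1)] \<alpha>all[OF u] k(2)[OF that(2)] chordal_Some_le[of "\<beta> u'" "\<beta> u"]
        by (simp add: chordal_eq_dist del: stereo_simps)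
    qed
    then show "\<exists>d>0. \<forall>u'\<in>{u0..s2}. dist u' u < d \<longrightarrow> dist (\<alpha> u') (\<alpha> u) < e" using k(1) by blast
  qed
  then have "continuous_on {u0..s2} (\<lambda>u. dist x0 (\<alpha> u))" by (intro continuous_intros)
  then obtain s1 where s1: "u0 \<le> s1" "s1 \<le> s2" "dist x0 (\<alpha> s1) = r1"
    using IVT'[of "\<lambda>u. dist x0 (\<alpha> u)" u0 r1 s2] \<alpha>u0 \<alpha>s2 r s2u by force
  have "(s1, s2, \<alpha>) \<in> path_family (sphere x0 r1) (sphere x0 r2) D"
    unfolding path_family_def using s1 \<alpha>s2 \<alpha>all D continuous_on_subset[OF \<alpha>c, of "{s1..s2}"]
    by (auto simp: subset_iff)
  then show ?thesis using s1 s2u \<alpha>all by (intro exI[of _ s1] exI[of _ s2] exI[of _ \<alpha>]) auto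
qed

text \<open>The path \<open>\<beta>\<close> runs from \<open>a\<close> at -1 through
  \<open>z\<close> at 0 to \<open>b\<close> at 1 and is \<open>L\<close>-Lipschitz. Arbitrary
  parameter intervals inside \<open>{-1..1}\<close> are allowed because lifting retains only a part
  of the path.\<close>

lemma ext_line_integral_two_segments:
  fixes \<rho> :: "'a::euclidean_space \<Rightarrow> ennreal"
  assumes [measurable]: "\<rho> \<in> borel_measurable borel" and L: "0 < L" "dist a z \<le> L" "dist b z \<le> L"
  defines "\<beta> \<equiv> (\<lambda>u. z + max 0 (- u) *\<^sub>R (a - z) + max 0 u *\<^sub>R (b - z))"
  assumes s: "-1 \<le> s1" "s2 \<le> 1" and g: "\<And>u. u \<in> {s1..s2} \<Longrightarrow> g u = Some (\<beta> u)"
  shows "loc_rectifiable s1 s2 g"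
    and "ext_line_integral \<rho> s1 s2 g \<le> ennreal L *
      (\<integral>\<^sup>+s\<in>{0<..1}. (\<rho> ((1 - s) *\<^sub>R a + s *\<^sub>R z) + \<rho> ((1 - s) *\<^sub>R b + s *\<^sub>R z)) \<partial>lborel)"
proof -
  have lip: "dist (\<beta> u) (\<beta> v) \<le> L * \<bar>u - v\<bar>" for u v
  proof -
    have "\<beta> u - \<beta> v = (max 0 (-u) - max 0 (-v)) *\<^sub>R (a - z) + (max 0 u - max 0 v) *\<^sub>R (b - z)"
      by (simp add: \<beta>_def algebra_simps)
    then have "dist (\<beta> u) (\<beta> v) \<le> \<bar>max 0 (-u) - max 0 (-v)\<bar> * dist a z + \<bar>max 0 u - max 0 v\<bar> * dist b z"
      by (metis dist_norm norm_scaleR norm_triangle_ineq)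
    also have "\<dots> \<le> \<bar>max 0 (-u) - max 0 (-v)\<bar> * L + \<bar>max 0 u - max 0 v\<bar> * L"
      using L by (intro add_mono mult_left_mono) auto
    also have "\<dots> = L * (\<bar>max 0 (-u) - max 0 (-v)\<bar> + \<bar>max 0 u - max 0 v\<bar>)" by (simp add: algebra_simps)
    also have "\<bar>max 0 (-u) - max 0 (-v)\<bar> + \<bar>max 0 u - max 0 v\<bar> = \<bar>u - v\<bar>"
      by (auto simp: max_def)
    finally show ?thesis .
  qed
  show "loc_rectifiable s1 s2 g"
    unfolding loc_rectifiable_def rectifiable_on_def
  proof clarify
    fix c d assume cd: "s1 \<le> c" "c \<le> d" "d \<le> s2"
    have "path_length (the \<circ> g) c d \<le> ennreal (L * (d - c))"
      using cd g lip L by (intro path_length_Lipschitz) auto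
    then show "path_length (the \<circ> g) c d < \<infinity>" using le_less_trans by fastforce
  qed
  have "continuous_on UNIV \<beta>" unfolding \<beta>_def by (intro continuous_intros)
  then have [measurable]: "\<beta> \<in> borel_measurable borel" by (rule borel_measurable_continuous_onI)
  have "ext_line_integral \<rho> s1 s2 g \<le> ennreal L * (\<integral>\<^sup>+u\<in>{s1..s2}. \<rho> (\<beta> u) \<partial>lborel)"
    by (rule ext_line_integral_Lipschitz_le[OF lip L(1) g]) auto
  also have "(\<integral>\<^sup>+u\<in>{s1..s2}. \<rho> (\<beta> u) \<partial>lborel)
      \<le> (\<integral>\<^sup>+u. \<rho> (\<beta> u) * indicator {-1<..0} u + \<rho> (\<beta> u) * indicator {0..<1} u \<partial>lborel)"
  \<comment> \<open>The end points -1 and 1 are null sets, and counting 0 twice only enlarges the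
    right side.\<close>
  proof (rule nn_integral_mono_AE)
    show "AE u in lborel. \<rho> (\<beta> u) * indicator {s1..s2} u
        \<le> \<rho> (\<beta> u) * indicator {-1<..0} u + \<rho> (\<beta> u) * indicator {0..<1} u"
      using AE_lborel_singleton[of "-1::real"] AE_lborel_singleton[of "1::real"]
      by eventually_elim (use s in \<open>auto simp: indicator_def\<close>)
  qed
  also have "\<dots> = (\<integral>\<^sup>+u. \<rho> (\<beta> u) * indicator {-1<..0} u \<partial>lborel) + (\<integral>\<^sup>+u. \<rho> (\<beta> u) * indicator {0..<1} u \<partial>lborel)"
    by (rule nn_integral_add) measurable
  also have "(\<integral>\<^sup>+u. \<rho> (\<beta> u) * indicator {-1<..0} u \<partial>lborel)
      = (\<integral>\<^sup>+s\<in>{0<..1}. \<rho> ((1 - s) *\<^sub>R a + s *\<^sub>R z) \<partial>lborel)"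
    by (subst nn_integral_real_affine[of _ 1 "-1"])
       (auto simp: indicator_def \<beta>_def algebra_simps intro!: nn_integral_cong)
  also have "(\<integral>\<^sup>+u. \<rho> (\<beta> u) * indicator {0..<1} u \<partial>lborel)
      = (\<integral>\<^sup>+s\<in>{0<..1}. \<rho> ((1 - s) *\<^sub>R b + s *\<^sub>R z) \<partial>lborel)"
    by (subst nn_integral_real_affine[of _ "-1" 1])
       (auto simp: indicator_def \<beta>_def algebra_simps intro!: nn_integral_cong)
  also have "(\<integral>\<^sup>+s\<in>{0<..1}. \<rho> ((1 - s) *\<^sub>R a + s *\<^sub>R z) \<partial>lborel) + (\<integral>\<^sup>+s\<in>{0<..1}. \<rho> ((1 - s) *\<^sub>R b + s *\<^sub>R z) \<partial>lborel)
    = (\<integral>\<^sup>+s\<in>{0<..1}. (\<rho> ((1 - s) *\<^sub>R a + s *\<^sub>R z) + \<rho> ((1 - s) *\<^sub>R b + s *\<^sub>R z)) \<partial>lborel)"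
    by (subst nn_integral_add[symmetric]) (auto simp: distrib_right)
  finally show "ext_line_integral \<rho> s1 s2 g \<le> ennreal L *
      (\<integral>\<^sup>+s\<in>{0<..1}. (\<rho> ((1 - s) *\<^sub>R a + s *\<^sub>R z) + \<rho> ((1 - s) *\<^sub>R b + s *\<^sub>R z)) \<partial>lborel)"
    by (simp add: mult_left_mono)
qed

text \<open>Every two-segment path from \<open>a\<close> through \<open>z\<close> to
  \<open>b\<close> contains the image of a path of the ring family, so each admissible
  \<open>\<rho>\<close> satisfies the hypothesis of \<open>crossing_log_estimate\<close>. For
  \<open>dist p z \<le> 3 * t\<close> both segments have length at most
  \<open>4 * t\<close>.\<close>

lemma modulus_crossing_estimate:
  fixes F :: "'a::euclidean_space \<Rightarrow> 'a option" and K :: real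
  defines "K \<equiv> 4 * (8 * (real DIM('a) - 1)) ^ (DIM('a) - 1) * 4 ^ DIM('a)"
  assumes n: "2 \<le> DIM('a)" and F: "chordal_homeo_into D F" and D: "cball x0 r2 \<subseteq> D"
    and r: "0 < r1" "r1 < r2" and t12: "0 < t1" "t1 \<le> t2"
    and cross: "\<And>t. t \<in> {t1..t2} \<Longrightarrow> \<exists>a b. dist p a = t \<and> dist p b = t \<and>
      Some a \<in> F ` cball x0 r1 \<and> Some b \<in> F ` (D - ball x0 r2)"
  shows "emeasure lborel (ball (0::'a) 1) * ennreal (ln (t2 / t1))
    \<le> ennreal (640 * K) * modulus (image_family F (path_family (sphere x0 r1) (sphere x0 r2) D))"
proof -
  let ?\<Gamma> = "path_family (sphere x0 r1) (sphere x0 r2) D"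
  let ?C = "emeasure lborel (ball (0::'a) 1) * ennreal (ln (t2 / t1))"
  have K: "0 < K" using n by (simp add: K_def)
  have est: "?C \<le> ennreal (640 * K) * (\<integral>\<^sup>+ x. \<rho> x ^ DIM('a) \<partial>lborel)"
    if \<rho>: "\<rho> \<in> borel_measurable borel"
      "\<forall>(a, b, g)\<in>image_family F ?\<Gamma>. loc_rectifiable a b g \<longrightarrow> 1 \<le> ext_line_integral \<rho> a b g" for \<rho>
    unfolding K_def
  proof (rule crossing_log_estimate[OF n \<rho>(1) t12])
    fix t assume t: "t \<in> {t1..t2}"
    then have t0: "0 < t" using t12 by auto
    obtain a b where ab: "dist p a = t" "dist p b = t"
      "Some a \<in> F ` cball x0 r1" "Some b \<in> F ` (D - ball x0 r2)" using cross[OF t] by blast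
    have "1 \<le> ennreal (4 * t) *
        (\<integral>\<^sup>+s\<in>{0<..1}. (\<rho> ((1 - s) *\<^sub>R a + s *\<^sub>R z) + \<rho> ((1 - s) *\<^sub>R b + s *\<^sub>R z)) \<partial>lborel)"
      if z: "dist p z \<le> 3 * t" for z
    proof -
      define \<beta> where "\<beta> u = z + max 0 (- u) *\<^sub>R (a - z) + max 0 u *\<^sub>R (b - z)" for u :: real
      have "continuous_on UNIV \<beta>" unfolding \<beta>_def by (intro continuous_intros)
      moreover have "Some (\<beta> (-1)) \<in> F ` cball x0 r1" "Some (\<beta> 1) \<in> F ` (D - ball x0 r2)"
        using ab by (simp_all add: \<beta>_def)
      ultimately obtain s1 s2 \<alpha> where s: "-1 \<le> s1" "s2 \<le> 1" "(s1, s2, \<alpha>) \<in> ?\<Gamma>"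
        "\<forall>u\<in>{s1..s2}. F (\<alpha> u) = Some (\<beta> u)"
        using lift_path_through_ring[OF F D r, of \<beta> "-1" 1] by auto
      have az: "dist a z \<le> 4 * t" "dist b z \<le> 4 * t"
        using dist_triangle[of a z p] dist_triangle[of b z p] ab z by (simp_all add: dist_commute)
      have g: "(F \<circ> \<alpha>) u = Some (z + max 0 (- u) *\<^sub>R (a - z) + max 0 u *\<^sub>R (b - z))" if "u \<in> {s1..s2}" for u
        using s(4) that by (simp add: \<beta>_def)
      have "(s1, s2, F \<circ> \<alpha>) \<in> image_family F ?\<Gamma>"
        using s(3) by (force simp: image_family_def)
      moreover have "loc_rectifiable s1 s2 (F \<circ> \<alpha>)"
        by (rule ext_line_integral_two_segments(1)[OF \<rho>(1) _ az s(1,2) g]) (use t0 in auto)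
      ultimately have "1 \<le> ext_line_integral \<rho> s1 s2 (F \<circ> \<alpha>)"
        using \<rho>(2) by blast
      also have "\<dots> \<le> ennreal (4 * t) *
        (\<integral>\<^sup>+s\<in>{0<..1}. (\<rho> ((1 - s) *\<^sub>R a + s *\<^sub>R z) + \<rho> ((1 - s) *\<^sub>R b + s *\<^sub>R z)) \<partial>lborel)"
        by (rule ext_line_integral_two_segments(2)[OF \<rho>(1) _ az s(1,2) g]) (use t0 in auto)
      finally show ?thesis .
    qed
    then show "\<exists>a b. dist p a = t \<and> dist p b = t \<and> (\<forall>z. dist p z \<le> 3 * t \<longrightarrow> 1 \<le> ennreal (4 * t) *
        (\<integral>\<^sup>+s\<in>{0<..1}. (\<rho> ((1 - s) *\<^sub>R a + s *\<^sub>R z) + \<rho> ((1 - s) *\<^sub>R b + s *\<^sub>R z)) \<partial>lborel))"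
      using ab by blast
  qed
  have inv: "ennreal (640 * K) * ennreal (1 / (640 * K)) = 1"
    using K by (subst ennreal_mult[symmetric]) auto
  then have inv': "ennreal (1 / (640 * K)) * ennreal (640 * K) = 1" by (simp only: mult.commute)
  \<comment> \<open>Dividing by the constant first lets the bound, valid for each admissible
    \<open>\<rho>\<close>, pass to the infimum.\<close>
  have "ennreal (1 / (640 * K)) * ?C \<le> modulus (image_family F ?\<Gamma>)"
    unfolding modulus_def
  proof (rule INF_greatest)
    fix \<rho> :: "'a \<Rightarrow> ennreal"
    assume "\<rho> \<in> {\<rho>. \<rho> \<in> borel_measurable borel \<and>
      (\<forall>(a, b, g)\<in>image_family F ?\<Gamma>. loc_rectifiable a b g \<longrightarrow> 1 \<le> ext_line_integral \<rho> a b g)}"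
    then have "?C \<le> ennreal (640 * K) * (\<integral>\<^sup>+ x. \<rho> x ^ DIM('a) \<partial>lborel)" using est by blast
    then have "ennreal (1 / (640 * K)) * ?C
        \<le> ennreal (1 / (640 * K)) * (ennreal (640 * K) * (\<integral>\<^sup>+ x. \<rho> x ^ DIM('a) \<partial>lborel))"
      by (rule mult_left_mono) simp
    also have "\<dots> = (\<integral>\<^sup>+ x. \<rho> x ^ DIM('a) \<partial>lborel)"
      by (simp only: mult.assoc[symmetric] inv' mult_1_left)
    finally show "ennreal (1 / (640 * K)) * ?C \<le> (\<integral>\<^sup>+ x. \<rho> x ^ DIM('a) \<partial>lborel)" .
  qed
  then have "ennreal (640 * K) * (ennreal (1 / (640 * K)) * ?C)
      \<le> ennreal (640 * K) * modulus (image_family F ?\<Gamma>)"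
    by (rule mult_left_mono) simp
  then show ?thesis by (simp only: mult.assoc[symmetric] inv mult_1_left)
qed

section \<open>Rigidity of the limit\<close>

text \<open>Frontier points of an open set lie outside it, hence at distance at least
  \<open>r3\<close>; the margin over \<open>r2\<close> gives strictness.\<close>

lemma less_dist_boundary:
  assumes "open D" "cball x0 r3 \<subseteq> D" "r2 < r3"
  shows "ereal r2 < dist_boundary D x0"
proof (cases "frontier D = {}")
  case False
  have "r3 \<le> dist x0 y" if "y \<in> frontier D" for y
    using that assms(1,2) by (force simp: frontier_def interior_open)
  then have "r3 \<le> infdist x0 (frontier D)"
    unfolding infdist_notempty[OF False] by (intro cINF_greatest[OF False])
  then show ?thesis using assms(3) False by (simp add: dist_boundary_def)
qed (simp add: dist_boundary_def)

text \<open>The test function is the constant \<open>1 / (r2 - r1)\<close>. The resulting bound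
  involves only \<open>D\<close>, \<open>Q\<close>, the centre and the radii, so it is the same for
  every \<open>F\<close>.\<close>

lemma ring_modulus_bounded:
  fixes D :: "'a::euclidean_space set"
  assumes "open D" "Q \<in> borel_measurable (lebesgue_on D)" "Lloc1_on D Q"
    and r: "0 < r1" "r1 < r2" "r2 < r3" "cball x0 r3 \<subseteq> D"
  shows "\<exists>B<\<infinity>. \<forall>F. ring_Q_ineq D Q F x0 (dist_boundary D x0) \<longrightarrow>
    modulus (image_family F (path_family (sphere x0 r1) (sphere x0 r2) D)) \<le> B"
proof -
  define c where "c = ennreal (1 / (r2 - r1))"
  define B where "B = (\<integral>\<^sup>+ x\<in>annulus x0 r1 r2 \<inter> D. Q x * c ^ DIM('a) \<partial>lebesgue)"
  have "c ^ DIM('a) < top" using r by (simp add: c_def ennreal_power)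
  have cD: "cball x0 r2 \<subseteq> D" using r(3,4) by auto
  have Dm: "D \<inter> space lebesgue \<in> sets lebesgue" using assms(1) by simp
  \<comment> \<open>\<open>Q\<close> is measurable only on \<open>D\<close>; the indicator extends
    it by 0.\<close>
  have QD [measurable]: "(\<lambda>x. Q x * indicator D x) \<in> borel_measurable lebesgue"
    using assms(2) borel_measurable_restrict_space_iff_ennreal[OF Dm] by blast
  have [measurable]: "cball x0 r2 \<in> sets lebesgue" by simp
  have "(\<lambda>x. Q x * indicator D x * indicator (cball x0 r2) x) \<in> borel_measurable lebesgue"
    by measurable
  moreover have "Q x * indicator D x * indicator (cball x0 r2) x = Q x * indicator (cball x0 r2) x" for x
    using cD by (auto simp: indicator_def)
  ultimately have Qc [measurable]: "(\<lambda>x. Q x * indicator (cball x0 r2) x) \<in> borel_measurable lebesgue" by simp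
  have "B \<le> (\<integral>\<^sup>+ x. Q x * indicator (cball x0 r2) x * c ^ DIM('a) \<partial>lebesgue)"
    unfolding B_def by (intro nn_integral_mono) (auto simp: indicator_def annulus_def dist_commute)
  also have "\<dots> = (\<integral>\<^sup>+ x\<in>cball x0 r2. Q x \<partial>lebesgue) * c ^ DIM('a)"
    by (rule nn_integral_multc[OF Qc])
  also have "\<dots> < \<infinity>"
    using assms(3) cD \<open>c ^ DIM('a) < top\<close> by (simp add: Lloc1_on_def ennreal_mult_less_top)
  finally have "B < \<infinity>" .
  moreover have "modulus (image_family F (path_family (sphere x0 r1) (sphere x0 r2) D)) \<le> B"
    if F: "ring_Q_ineq D Q F x0 (dist_boundary D x0)" for F
  proof -
    have "(\<integral>\<^sup>+ r\<in>{r1<..<r2}. c \<partial>lborel) = c * ennreal (r2 - r1)"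
      using r by (simp add: nn_integral_cmult_indicator)
    also have "\<dots> = 1" using r by (simp add: c_def ennreal_mult[symmetric])
    finally show ?thesis
      using F r(1,2) less_dist_boundary[OF assms(1) r(4,3)]
      unfolding ring_Q_ineq_def B_def by (elim allE[of _ r1] allE[of _ r2] allE[of _ "\<lambda>_. c"]) auto
  qed
  ultimately show ?thesis by blast
qed

text \<open>By \<open>acc\<close> the value at \<open>y\<close> need only be approached off the
  outer ball. An attained value serves the injectivity of \<open>f\<close>, an approached one the
  continuity of its inverse.\<close>

lemma limit_ring_rigidity:
  fixes D :: "'a::euclidean_space set"
  assumes n: "2 \<le> DIM('a)" and D: "open D" "connected D"
    and Q: "Q \<in> borel_measurable (lebesgue_on D)" "Lloc1_on D Q"
    and homeo: "\<And>m. chordal_homeo_into D (fs m)"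
    and ring: "\<And>m. ring_Q_ineq D Q (fs m) x0 (dist_boundary D x0)"
    and lim: "\<And>x. x \<in> D \<Longrightarrow> (\<lambda>m. stereo (fs m x)) \<longlonglongrightarrow> stereo (f x)"
    and r: "0 < r1" "r1 < r2" "r2 < r3" "cball x0 r3 \<subseteq> D"
    and y: "y \<in> cball x0 r1"
    and acc: "\<And>e. 0 < e \<Longrightarrow> \<exists>y0\<in>D - ball x0 r2. dist (stereo (f y0)) (stereo (f y)) < e"
    and y': "y' \<in> cball x0 r1" "f y' \<noteq> f y"
  shows "\<forall>y0\<in>D - ball x0 r2. f y0 = f y"
proof (rule ccontr)
  assume "\<not> ?thesis"
  then obtain y0' where y0': "y0' \<in> D - ball x0 r2" "f y0' \<noteq> f y" by blast
  define K where "K = 4 * (8 * (real DIM('a) - 1)) ^ (DIM('a) - 1) * 4 ^ DIM('a)"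
  obtain B where B: "B < \<infinity>" "\<And>m. modulus (image_family (fs m) (path_family (sphere x0 r1) (sphere x0 r2) D)) \<le> B"
    using ring_modulus_bounded[OF D(1) Q r] ring by blast
  have cD: "cball x0 r1 \<subseteq> D" "cball x0 r2 \<subseteq> D" using r by auto
  \<comment> \<open>The four strict inequalities are open conditions, so they pass from
    \<open>f\<close> to some \<open>fs m\<close>. Connectedness of the inner ball and of
    \<open>D\<close> minus the outer ball then yields the crossings.\<close>
  have bound: "emeasure lborel (ball (0::'a) 1) * ennreal (ln (t2 / t1)) \<le> ennreal (640 * K) * B"
    if t: "0 < t1" "t1 \<le> t2"
      and a: "a \<in> cball x0 r1" "sphere_side p t1 (stereo (f a)) < 0"
      and b: "b \<in> cball x0 r1" "0 < sphere_side p t2 (stereo (f b))"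
      and c: "c \<in> D - ball x0 r2" "sphere_side p t1 (stereo (f c)) < 0"
      and d: "d \<in> D - ball x0 r2" "0 < sphere_side p t2 (stereo (f d))" for p t1 t2 a b c d
  proof -
    have conv: "(\<lambda>m. sphere_side p t (stereo (fs m x))) \<longlonglongrightarrow> sphere_side p t (stereo (f x))" if "x \<in> D" for t x
      using continuous_on_tendsto_compose[OF continuous_on_sphere_side[of UNIV p t] lim[OF that]] by simp
    have "eventually (\<lambda>m. sphere_side p t1 (stereo (fs m a)) < 0 \<and> 0 < sphere_side p t2 (stereo (fs m b))
      \<and> sphere_side p t1 (stereo (fs m c)) < 0 \<and> 0 < sphere_side p t2 (stereo (fs m d))) sequentially"
      using a b c d cD by (intro eventually_conj order_tendstoD[OF conv]) auto
    then obtain m where m: "sphere_side p t1 (stereo (fs m a)) < 0" "0 < sphere_side p t2 (stereo (fs m b))"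
      "sphere_side p t1 (stereo (fs m c)) < 0" "0 < sphere_side p t2 (stereo (fs m d))"
      by (auto dest: eventually_happens)
    note cont = chordal_homeo_intoD(2)[OF homeo[of m]]
    have "\<exists>a b. dist p a = t \<and> dist p b = t \<and> Some a \<in> fs m ` cball x0 r1 \<and> Some b \<in> fs m ` (D - ball x0 r2)"
      if "t \<in> {t1..t2}" for t
    proof -
      have "\<exists>a. dist p a = t \<and> Some a \<in> fs m ` cball x0 r1"
        using connected_crosses_sphere[OF connected_cball _ t(1) _ _ a(1) m(1) b(1) m(2)]
          continuous_on_subset[OF cont cD(1)] that by auto
      moreover have "\<exists>a. dist p a = t \<and> Some a \<in> fs m ` (D - ball x0 r2)"
        using connected_crosses_sphere[OF connected_diff_ball[OF D(2) cD(2) n] _ t(1) _ _ c(1) m(3) d(1) m(4)]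
          continuous_on_subset[OF cont Diff_subset] that by auto
      ultimately show ?thesis by blast
    qed
    from modulus_crossing_estimate[OF n homeo cD(2) r(1,2) t this]
    have "emeasure lborel (ball (0::'a) 1) * ennreal (ln (t2 / t1))
      \<le> ennreal (640 * K) * modulus (image_family (fs m) (path_family (sphere x0 r1) (sphere x0 r2) D))"
      unfolding K_def .
    also have "\<dots> \<le> ennreal (640 * K) * B" by (intro mult_left_mono B) simp
    finally show ?thesis .
  qed
  \<comment> \<open>\<open>B\<close> is finite and the unit ball has positive volume, so a large
    enough logarithm violates \<open>bound\<close>.\<close>
  have unbounded: "\<exists>R>0. \<not> emeasure lborel (ball (0::'a) 1) * ennreal R \<le> ennreal (640 * K) * B"
  proof -
    define v where "v = measure lborel (ball (0::'a) 1)"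
    have v: "emeasure lborel (ball (0::'a) 1) = ennreal v" "0 < v"
      using unit_ball_vol_pos[of "DIM('a)"] unfolding v_def
      by (simp_all add: emeasure_eq_ennreal_measure emeasure_ball content_ball)
    have "ennreal (640 * K) * B < top" using B(1) by (simp add: ennreal_mult_less_top)
    then obtain C where C: "ennreal (640 * K) * B = ennreal C" "0 \<le> C" by (cases "ennreal (640 * K) * B") auto
    have "v * ((C + 1) / v) = C + 1" using v by simp
    then have "\<not> ennreal v * ennreal ((C + 1) / v) \<le> ennreal C"
      using v C by (subst ennreal_mult[symmetric]) auto
    then show ?thesis using v C by (intro exI[of _ "(C + 1) / v"]) (auto simp: add_nonneg_pos)
  qed
  then obtain R where R: "0 < R" "\<not> emeasure lborel (ball (0::'a) 1) * ennreal R \<le> ennreal (640 * K) * B" by blast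
  \<comment> \<open>Turns \<open>acc\<close> into a transfer rule: an open condition true at
    \<open>stereo (f y)\<close> also holds at a value of \<open>f\<close> off the outer
    ball.\<close>
  have near: "\<exists>y0\<in>D - ball x0 r2. S (stereo (f y0))"
    if S: "open {q. S q}" "S (stereo (f y))" for S :: "'a \<times> real \<Rightarrow> bool"
  proof -
    obtain e where e: "0 < e" "ball (stereo (f y)) e \<subseteq> {q. S q}"
      using S unfolding open_contains_ball by blast
    obtain y0 where "y0 \<in> D - ball x0 r2" "dist (stereo (f y0)) (stereo (f y)) < e" using acc[OF e(1)] by blast
    then show ?thesis using subsetD[OF e(2), of "stereo (f y0)"] by (auto simp: dist_commute)
  qed
  have opn: "open {q. sphere_side p t q < 0}" "open {q. 0 < sphere_side p t q}" for p :: 'a and t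
    using continuous_on_sphere_side by (auto intro!: open_Collect_less continuous_on_const)
  show False
  proof (cases "f y")
    case (Some p)
    have away: "\<exists>T>0. \<forall>t. 0 < t \<and> t \<le> T \<longrightarrow> 0 < sphere_side p t (stereo u)" if "u \<noteq> Some p" for u
    proof (cases u)
      case None then show ?thesis by (auto intro: exI[of _ 1] simp del: stereo_simps)
    next
      case (Some w)
      then have "0 < dist p w" using that by auto
      then show ?thesis using Some
        by (intro exI[of _ "dist p w / 2"]) (auto simp: sphere_side_pos_iff simp del: stereo_simps)
    qed
    obtain T1 T2 where T: "0 < T1" "\<And>t. 0 < t \<Longrightarrow> t \<le> T1 \<Longrightarrow> 0 < sphere_side p t (stereo (f y'))"
      "0 < T2" "\<And>t. 0 < t \<Longrightarrow> t \<le> T2 \<Longrightarrow> 0 < sphere_side p t (stereo (f y0'))"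
      using away[of "f y'"] away[of "f y0'"] y' y0' Some by metis
    \<comment> \<open>The sphere of radius \<open>t2\<close> leaves the values at \<open>y'\<close>
      and \<open>y0'\<close> outside; \<open>t1\<close> is then made so small that the logarithm
      equals \<open>R\<close>, and \<open>near\<close> still finds a point off the outer ball whose
      value is inside.\<close>
    define t2 where "t2 = min T1 T2"
    define t1 where "t1 = t2 / exp R"
    have "0 < t2" using T by (simp add: t2_def)
    then have t: "0 < t1" "t1 \<le> t2" "ln (t2 / t1) = R" using R by (simp_all add: t1_def divide_le_eq)
    have neg: "sphere_side p t1 (stereo (f y)) < 0"
      using t by (subst sphere_side_neg_iff) (auto simp: Some)
    obtain y0 where y0: "y0 \<in> D - ball x0 r2" "sphere_side p t1 (stereo (f y0)) < 0"
      using near[OF opn(1) neg] by blast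
    have "0 < sphere_side p t2 (stereo (f y'))" "0 < sphere_side p t2 (stereo (f y0'))"
      using T \<open>0 < t2\<close> by (auto simp: t2_def)
    then show False using bound[OF t(1,2) y neg y'(1) _ y0 y0'(1)] R t(3) by simp
  next
    case None
    obtain w1 w2 where w: "f y' = Some w1" "f y0' = Some w2" using y' y0' None by auto
    \<comment> \<open>For the value infinity the spheres are centred at 0 and the roles swap:
      \<open>y'\<close> and \<open>y0'\<close> map inside radius \<open>t1\<close>, while
      \<open>y\<close> and \<open>y0\<close> map outside radius \<open>t2\<close>.\<close>
    define t1 where "t1 = 1 + norm w1 + norm w2"
    define t2 where "t2 = t1 * exp R"
    have t1: "0 < t1" by (auto simp: t1_def add_pos_nonneg)
    then have t: "t1 \<le> t2" "ln (t2 / t1) = R" using R by (auto simp: t2_def)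
    have pos: "0 < sphere_side 0 t2 (stereo (f y))" using None by (simp del: stereo_simps)
    obtain y0 where y0: "y0 \<in> D - ball x0 r2" "0 < sphere_side 0 t2 (stereo (f y0))"
      using near[OF opn(2) pos] by blast
    have "sphere_side 0 t1 (stereo (f y')) < 0" "sphere_side 0 t1 (stereo (f y0')) < 0"
      using t1 w by (auto simp: sphere_side_neg_iff simp del: stereo_simps) (auto simp: t1_def add_pos_nonneg add.commute add_strict_increasing)
    then show False using bound[OF t1 t(1) y'(1) _ y pos y0'(1) _ y0] R t(2) by simp
  qed
qed

section \<open>Continuity, injectivity and finiteness of the limit map\<close>

lemma chordal_locally_uniformD:
  assumes "chordal_locally_uniform D fs f" "x \<in> D"
  shows "\<exists>r>0. ball x r \<subseteq> D \<and> uniform_limit (ball x r) (\<lambda>m y. stereo (fs m y)) (\<lambda>y. stereo (f y)) sequentially"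
  using assms unfolding chordal_locally_uniform_def uniform_limit_iff eventually_sequentially chordal_eq_dist
  by blast

lemma limit_continuous:
  assumes "chordal_locally_uniform D fs f" "\<And>m. chordal_homeo_into D (fs m)"
  shows "continuous_on D (\<lambda>x. stereo (f x))"
proof -
  have "isCont (\<lambda>x. stereo (f x)) x" if x: "x \<in> D" for x
  proof -
    obtain r where r: "0 < r" "ball x r \<subseteq> D"
      "uniform_limit (ball x r) (\<lambda>m y. stereo (fs m y)) (\<lambda>y. stereo (f y)) sequentially"
      using chordal_locally_uniformD[OF assms(1) x] by blast
    have "continuous_on (ball x r) (\<lambda>y. stereo (f y))"
      using chordal_homeo_intoD(2)[OF assms(2)] r(2)
      by (intro uniform_limit_theorem[OF _ r(3)] always_eventually) (auto intro: continuous_on_subset)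
    then show ?thesis using r(1) by (simp add: continuous_on_eq_continuous_at)
  qed
  then show ?thesis by (simp add: continuous_at_imp_continuous_on)
qed

lemma limit_pointwise:
  assumes "chordal_locally_uniform D fs f" "x \<in> D"
  shows "(\<lambda>m. stereo (fs m x)) \<longlonglongrightarrow> stereo (f x)"
proof -
  obtain r where r: "0 < r"
    "uniform_limit (ball x r) (\<lambda>m y. stereo (fs m y)) (\<lambda>y. stereo (f y)) sequentially"
    using chordal_locally_uniformD[OF assms] by blast
  show ?thesis by (rule tendsto_uniform_limitI[OF r(2)]) (simp add: r(1))
qed

text \<open>If \<open>f\<close> takes a value twice, rigidity makes it constant near one of the two points or off a ball
  around it, hence constant on an open set. At a boundary point \<open>z\<close> of the interior of that level
  set, rigidity then forces \<open>f\<close> to be constant off every small ball around \<open>z\<close>.\<close>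
lemma limit_inj_or_constant:
  fixes D :: "'a::euclidean_space set"
  assumes D: "open D" "connected D"
    and cont: "continuous_on D (\<lambda>x. stereo (f x))"
    and rigid: "\<And>x0 r1 r2 r3 y y' y0 y0'. \<lbrakk>0 < r1; r1 < r2; r2 < r3; cball x0 r3 \<subseteq> D; y \<in> cball x0 r1;
      y0 \<in> D - ball x0 r2; f y0 = f y; y' \<in> cball x0 r1; f y' \<noteq> f y; y0' \<in> D - ball x0 r2\<rbrakk> \<Longrightarrow> f y0' = f y"
  shows "inj_on f D \<or> (\<exists>c. \<forall>x\<in>D. f x = c)"
proof (rule disjCI)
  assume nc: "\<nexists>c. \<forall>x\<in>D. f x = c"
  show "inj_on f D"
  proof (rule ccontr)
    assume "\<not> inj_on f D"
    then obtain y y0 where y: "y \<in> D" "y0 \<in> D" "y \<noteq> y0" "f y0 = f y" by (auto simp: inj_on_def)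
    define c where "c = f y"
    define U where "U = interior {x\<in>D. f x = c}"
    have U: "open U" "U \<subseteq> D" "\<And>x. x \<in> U \<Longrightarrow> f x = c"
      using interior_subset by (auto simp: U_def)
    have Umax: "W \<subseteq> U" if "open W" "W \<subseteq> D" "\<And>x. x \<in> W \<Longrightarrow> f x = c" for W
      unfolding U_def using that by (intro interior_maximal) auto
    have "U \<noteq> {}"
    proof -
      obtain r3 where r3: "0 < r3" "cball y r3 \<subseteq> D" using D(1) y(1) open_contains_cball by blast
      \<comment> \<open>Below \<open>dist y y0\<close>, so that the value \<open>c\<close> occurs on
        both sides of the ring around \<open>y\<close>.\<close>
      define r2 where "r2 = min r3 (dist y y0) / 2"
      have r2: "0 < r2" "r2 < r3" "r2 < dist y y0" using r3 y by (auto simp: r2_def min_def)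
      have y0r: "y0 \<in> D - ball y r2" using y r2 by auto
      show ?thesis
      proof (cases "\<forall>y'\<in>cball y (r2 / 2). f y' = c")
        case True
        then have "ball y (r2 / 2) \<subseteq> U" using r2 r3 by (intro Umax) (auto simp: subset_iff)
        then show ?thesis using r2 by (metis centre_in_ball empty_iff half_gt_zero subsetD)
      next
        case False
        then obtain y' where y': "y' \<in> cball y (r2 / 2)" "f y' \<noteq> c" by blast
        have "f x = c" if "x \<in> D - ball y r2" for x
          using rigid[of "r2 / 2" r2 r3 y y y0 y' x] r2 r3 y0r y' y that by (simp add: c_def)
        then have "D - cball y r2 \<subseteq> U" using D(1) by (intro Umax) auto
        moreover have "y0 \<in> D - cball y r2" using y r2 by auto
        ultimately show ?thesis by blast
      qed
    qed
    have "\<not> D \<subseteq> U" using nc U by blast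
    \<comment> \<open>Otherwise \<open>U\<close> and the complement of its closure would separate
      the connected set \<open>D\<close>.\<close>
    moreover have "D \<subseteq> U" if "D \<inter> closure U \<subseteq> U"
    proof -
      have "U \<inter> D = {} \<or> - closure U \<inter> D = {}"
        using that U(1) closure_subset[of U] by (intro connectedD[OF D(2)]) auto
      then show ?thesis using \<open>U \<noteq> {}\<close> U(2) that by blast
    qed
    ultimately obtain z where z: "z \<in> D" "z \<in> closure U" "z \<notin> U" by blast
    obtain u where u: "u \<in> U" using \<open>U \<noteq> {}\<close> by blast
    have uz: "0 < dist z u" using u z by auto
    obtain r3 where r3: "0 < r3" "cball z r3 \<subseteq> D" using D(1) z(1) open_contains_cball by blast
    \<comment> \<open>The ball around \<open>z\<close> is so small that \<open>x\<close> and
      \<open>u\<close> lie outside. The value \<open>c\<close> is taken at \<open>v\<close> inside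
      and at \<open>u\<close> outside, and maximality of \<open>U\<close> prevents \<open>f\<close>
      from being constantly \<open>c\<close> on the inner ball, so rigidity reaches
      \<open>x\<close>.\<close>
    have off: "f x = c" if x: "x \<in> D" "x \<noteq> z" for x
    proof -
      define r where "r = min r3 (min (dist z u) (dist z x)) / 2"
      have r: "0 < r" "r < r3" "r < dist z u" "r < dist z x"
      proof -
        have "0 < min r3 (min (dist z u) (dist z x))" using r3 uz x by simp
        moreover have "min r3 (min (dist z u) (dist z x)) \<le> r3"
          "min r3 (min (dist z u) (dist z x)) \<le> dist z u" "min r3 (min (dist z u) (dist z x)) \<le> dist z x"
          by (simp_all add: min.coboundedI2)
        ultimately show "0 < r" "r < r3" "r < dist z u" "r < dist z x" unfolding r_def by linarith+
      qed
      obtain v where v: "v \<in> U" "dist v z < r / 2" using z(2) r(1) closure_approachable half_gt_zero by blast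
      have "\<not> (\<forall>y'\<in>cball z (r / 2). f y' = c)"
      proof
        assume "\<forall>y'\<in>cball z (r / 2). f y' = c"
        then have "ball z (r / 2) \<subseteq> U" using r r3 by (intro Umax) (auto simp: subset_iff)
        then show False using r z(3) by (metis centre_in_ball half_gt_zero subsetD)
      qed
      then obtain y' where y': "y' \<in> cball z (r / 2)" "f y' \<noteq> c" by blast
      have "f x = f v"
        by (rule rigid[of "r / 2" r r3 z v u y' x]) (use r r3 v u y' x U in \<open>auto simp: dist_commute\<close>)
      then show ?thesis using v U by simp
    qed
    moreover have "f z = c"
    proof (rule ccontr)
      assume "f z \<noteq> c"
      then have "0 < dist (stereo c) (stereo (f z))" using stereo_inj by (metis zero_less_dist_iff)
      then obtain d where d: "0 < d" "\<And>x. x \<in> D \<Longrightarrow> dist x z < d \<Longrightarrow> dist (stereo (f x)) (stereo (f z)) < dist (stereo c) (stereo (f z))"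
        using cont z(1) unfolding continuous_on_iff by meson
      obtain v where "v \<in> U" "dist v z < d" using z(2) d(1) closure_approachable by blast
      then show False using d(2)[of v] U by auto
    qed
    ultimately show False using nc by metis
  qed
qed

text \<open>A maximum principle: if \<open>f x0\<close> were infinity, some \<open>fs m\<close>
  would have larger norm at \<open>x0\<close> than on a small sphere around it. Its norm would then
  have an interior maximum, contradicting the openness of the image of the ball.\<close>

lemma limit_finite:
  fixes D :: "'a::euclidean_space set"
  assumes n: "2 \<le> DIM('a)" and D: "open D"
    and homeo: "\<And>m. chordal_homeo_into D (fs m)"
    and unif: "chordal_locally_uniform D fs f"
    and inj: "inj_on f D" and fin: "\<And>m x. x \<in> D \<Longrightarrow> fs m x \<noteq> None" and x0: "x0 \<in> D"
  shows "f x0 \<noteq> None"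
proof
  assume inf: "f x0 = None"
  obtain r' where r': "0 < r'" "ball x0 r' \<subseteq> D"
    "uniform_limit (ball x0 r') (\<lambda>m y. stereo (fs m y)) (\<lambda>y. stereo (f y)) sequentially"
    using chordal_locally_uniformD[OF unif x0] by blast
  define r where "r = r' / 2"
  have r: "0 < r" "cball x0 r \<subseteq> ball x0 r'" using r' by (auto simp: r_def)
  have sub: "sphere x0 r \<subseteq> ball x0 r'" "cball x0 r \<subseteq> D" "sphere x0 r \<subseteq> D" "ball x0 r \<subseteq> D"
    using r r'(2) sphere_cball[of x0 r] ball_subset_cball[of x0 r] by blast+
  have "continuous_on (sphere x0 r) (\<lambda>x. snd (stereo (f x)))"
    using limit_continuous[OF unif homeo] sub by (intro continuous_intros) (auto intro: continuous_on_subset)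
  moreover have "sphere x0 r \<noteq> {}" using r by simp
  ultimately obtain xs where xs: "xs \<in> sphere x0 r" "\<And>x. x \<in> sphere x0 r \<Longrightarrow> snd (stereo (f x)) \<le> snd (stereo (f xs))"
    using continuous_attains_sup[OF compact_sphere] by metis
  have "xs \<noteq> x0" using xs(1) r(1) by auto
  moreover have "xs \<in> D" using xs(1) sub(3) by blast
  ultimately have "f xs \<noteq> None" using inf inj x0 by (metis inj_onD)
  \<comment> \<open>A third of the gap: on the sphere the last coordinate for \<open>fs m\<close>
    stays below \<open>1 - 2 * \<kappa>\<close>, while at \<open>x0\<close> it exceeds
    \<open>1 - \<kappa>\<close>.\<close>
  define \<kappa> where "\<kappa> = (1 - snd (stereo (f xs))) / 3"
  have \<kappa>: "0 < \<kappa>" using snd_stereo_less[OF \<open>f xs \<noteq> None\<close>] by (simp add: \<kappa>_def)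
  obtain m where m: "\<And>y. y \<in> ball x0 r' \<Longrightarrow> dist (stereo (fs m y)) (stereo (f y)) < \<kappa>"
    using r'(3) \<kappa> unfolding uniform_limit_iff eventually_sequentially by blast
  have m': "\<bar>snd (stereo (fs m y)) - snd (stereo (f y))\<bar> < \<kappa>" if "y \<in> ball x0 r'" for y
    using dist_snd_le[of "stereo (fs m y)" "stereo (f y)"] m[OF that] by (simp add: dist_real_def)
  have bd: "snd (stereo (fs m x)) < snd (stereo (fs m x0))" if x: "x \<in> sphere x0 r" for x
  proof -
    have "x \<in> ball x0 r'" "x0 \<in> ball x0 r'" using x sub r' by auto
    then have "snd (stereo (fs m x)) < snd (stereo (f x)) + \<kappa>" "1 - \<kappa> < snd (stereo (fs m x0))"
      using m'[of x] m'[of x0] inf by (auto simp: abs_less_iff)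
    moreover have "3 * \<kappa> = 1 - snd (stereo (f xs))" by (simp add: \<kappa>_def)
    ultimately show ?thesis using xs(2)[OF x] \<kappa> by linarith
  qed
  have "continuous_on (cball x0 r) (\<lambda>x. snd (stereo (fs m x)))"
    using chordal_homeo_intoD(2)[OF homeo] sub by (intro continuous_intros) (auto intro: continuous_on_subset)
  then obtain xm where xm: "xm \<in> cball x0 r" "\<And>x. x \<in> cball x0 r \<Longrightarrow> snd (stereo (fs m x)) \<le> snd (stereo (fs m xm))"
    using continuous_attains_sup[OF compact_cball, of x0 r] r by force
  have "xm \<notin> sphere x0 r" using bd[of xm] xm(2)[of x0] r by auto
  then have xmb: "xm \<in> ball x0 r" using xm(1) by auto
  obtain w where w: "fs m xm = Some w" using fin xm(1) sub by blast
  define V where "V = {w. Some w \<in> fs m ` ball x0 r}"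
  have "open V" unfolding V_def
    using chordal_homeo_intoD(1,2)[OF homeo[of m]] sub(4)
    by (intro open_finite_part_image) (auto intro: inj_on_subset continuous_on_subset)
  moreover have "w \<in> V" using w xmb by (force simp: V_def)
  ultimately obtain e where e: "0 < e" "cball w e \<subseteq> V" using open_contains_cball by blast
  \<comment> \<open>Moving \<open>w\<close> in a direction with nonnegative inner product strictly
    increases the norm, also when \<open>w = 0\<close>.\<close>
  obtain v where v: "norm v = 1" "0 \<le> w \<bullet> v" using exists_unit_common_halfspace[OF n, of w w] by blast
  have "w + e *\<^sub>R v \<in> V" using e v by (intro subsetD[OF e(2)]) (simp add: dist_norm)
  then obtain x where x: "x \<in> ball x0 r" "fs m x = Some (w + e *\<^sub>R v)" by (force simp: V_def)
  have "v \<bullet> v = 1" using v(1) by (simp add: dot_square_norm)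
  then have "(norm (w + e *\<^sub>R v))\<^sup>2 = (norm w)\<^sup>2 + 2 * e * (w \<bullet> v) + e\<^sup>2"
    unfolding power2_norm_eq_inner using \<open>v \<bullet> v = 1\<close>
    by (simp add: inner_add_left inner_add_right inner_commute power2_eq_square algebra_simps)
  moreover have "0 \<le> 2 * e * (w \<bullet> v)" "0 < e\<^sup>2" using e v by auto
  ultimately have "(norm w)\<^sup>2 < (norm (w + e *\<^sub>R v))\<^sup>2" by linarith
  then have "snd (stereo (Some w)) < snd (stereo (Some (w + e *\<^sub>R v)))"
    using one_plus_norm_sq_pos[of w] one_plus_norm_sq_pos[of "w + e *\<^sub>R v"]
    by (simp add: divide_less_eq less_divide_eq) (simp add: field_simps)
  then show False using xm(2)[of x] x w by (simp del: stereo_simps)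
qed

text \<open>As the chordal distance is at most the Euclidean one, chordal continuity of the inverse
  implies its Euclidean continuity.\<close>

lemma homeomorphism_of_chordal_homeo:
  fixes f :: "'a::euclidean_space \<Rightarrow> 'a option"
  assumes f: "chordal_homeo_into D f" and fin: "\<And>x. x \<in> D \<Longrightarrow> f x \<noteq> None"
  shows "\<exists>g g'. (\<forall>x\<in>D. f x = Some (g x)) \<and> homeomorphism D (g ` D) g g'"
proof -
  define g where "g x = the (f x)" for x
  have g: "f x = Some (g x)" if "x \<in> D" for x using fin[OF that] by (simp add: g_def)
  have inj: "inj_on g D" using chordal_homeo_intoD(1)[OF f] g by (auto simp: inj_on_def)
  have "continuous_on D g"
    unfolding g_def by (rule continuous_on_the_stereo[OF chordal_homeo_intoD(2)[OF f] fin])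
  moreover have "continuous_on (g ` D) (inv_into D g)"
    unfolding continuous_on_iff
  proof (intro ballI allI impI, elim imageE)
    fix q x and e :: real assume q: "q = g x" "x \<in> D" and e: "0 < e"
    obtain d where d: "0 < d" "\<And>y. y \<in> D \<Longrightarrow> dist (stereo (f y)) (stereo (f x)) < d \<Longrightarrow> dist y x < e"
      using chordal_homeo_intoD(3)[OF f q(2) e] by blast
    have "dist (inv_into D g (g y)) (inv_into D g q) < e" if "y \<in> D" "dist (g y) q < d" for y
      using d(2)[OF that(1)] chordal_Some_le[of "g y" "g x"] that q g inj
      by (simp add: chordal_eq_dist del: stereo_simps)
    then show "\<exists>d>0. \<forall>q'\<in>g ` D. dist q' q < d \<longrightarrow> dist (inv_into D g q') (inv_into D g q) < e"
      using d(1) by blast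
  qed
  ultimately have "homeomorphism D (g ` D) g (inv_into D g)"
    using inj by (auto simp: homeomorphism_def inv_into_f_f image_iff)
  then show ?thesis using g by blast
qed

section \<open>The dichotomy for the limit, with continuity of the inverse from rigidity\<close>

theorem theorem1:
  fixes D :: "'a::euclidean_space set"
    and Q :: "'a \<Rightarrow> ennreal"
    and fs :: "nat \<Rightarrow> 'a \<Rightarrow> 'a option"
    and f :: "'a \<Rightarrow> 'a option"
  assumes "DIM('a) \<ge> 2"
    and "open D" and "connected D" and "D \<noteq> {}"
    and "Q \<in> borel_measurable (lebesgue_on D)"
    and "Lloc1_on D Q"
    and "\<And>m. chordal_homeo_into D (fs m)"
    and "\<And>m x0. x0 \<in> D \<Longrightarrow> ring_Q_ineq D Q (fs m) x0 (dist_boundary D x0)"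
    and "chordal_locally_uniform D fs f"
  shows "(chordal_homeo_into D f \<or> (\<exists>c. \<forall>x\<in>D. f x = c)) \<and>
         ((\<forall>m. \<forall>x\<in>D. fs m x \<noteq> None) \<longrightarrow>
            (\<exists>g g'. (\<forall>x\<in>D. f x = Some (g x)) \<and> homeomorphism D (g ` D) g g')
            \<or> (\<exists>c. \<forall>x\<in>D. f x = c))"
proof -
  note lim = limit_pointwise[OF assms(9)]
  have cont: "continuous_on D (\<lambda>x. stereo (f x))" by (rule limit_continuous[OF assms(9,7)])
  have rigid: "f y0' = f y"
    if r: "0 < r1" "r1 < r2" "r2 < r3" "cball x0 r3 \<subseteq> D"
      and y: "y \<in> cball x0 r1" "\<And>e. 0 < e \<Longrightarrow> \<exists>y0\<in>D - ball x0 r2. dist (stereo (f y0)) (stereo (f y)) < e"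
        "y' \<in> cball x0 r1" "f y' \<noteq> f y" "y0' \<in> D - ball x0 r2"
    for x0 r1 r2 r3 y y' y0'
  proof -
    have "x0 \<in> D" using r by (auto simp: subset_iff)
    from limit_ring_rigidity[OF assms(1,2,3,5,6,7) assms(8)[OF this] lim r y(1-4)] y(5)
    show ?thesis by blast
  qed
  have dich: "inj_on f D \<or> (\<exists>c. \<forall>x\<in>D. f x = c)"
  proof (rule limit_inj_or_constant[OF assms(2,3) cont])
    fix x0 r1 r2 r3 y y' y0 y0'
    assume r: "0 < r1" "r1 < r2" "r2 < r3" "cball x0 r3 \<subseteq> D" "y \<in> cball x0 r1"
      and y0: "y0 \<in> D - ball x0 r2" "f y0 = f y"
      and y': "y' \<in> cball x0 r1" "f y' \<noteq> f y" "y0' \<in> D - ball x0 r2"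
    show "f y0' = f y"
      by (rule rigid[OF r _ y']) (use y0 in \<open>auto intro!: bexI[of _ y0]\<close>)
  qed
  have homeo: "chordal_homeo_into D f" if inj: "inj_on f D"
    unfolding chordal_homeo_into_def chordal_continuous_on_iff chordal_eq_dist
  proof (intro conjI inj cont ballI allI impI)
    fix x and e :: real assume x: "x \<in> D" and e: "0 < e"
    show "\<exists>d>0. \<forall>y\<in>D. dist (stereo (f y)) (stereo (f x)) < d \<longrightarrow> dist y x < e"
    proof (rule ccontr)
      assume contr: "\<not> ?thesis"
      obtain r3 where r3: "0 < r3" "cball x r3 \<subseteq> D" using assms(2) x open_contains_cball by blast
      \<comment> \<open>If the inverse fails to be continuous, points at distance at least
        \<open>e\<close> from \<open>x\<close> have values approaching \<open>f x\<close>. By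
        \<open>r2 \<le> e\<close> they lie off \<open>ball x r2\<close>, as \<open>rigid\<close>
        with \<open>y = x\<close> requires.\<close>
      define r2 where "r2 = min e r3 / 2"
      have r2: "0 < r2" "r2 < r3" "r2 \<le> e" using e r3 by (auto simp: r2_def min_def)
      \<comment> \<open>One point in the inner ball and one off the outer ball; by injectivity
        neither takes the value \<open>f x\<close>, which contradicts the conclusion of
        \<open>rigid\<close>.\<close>
      obtain y' where "dist x y' = r2 / 2" by (rule vector_choose_dist[of "r2 / 2" x]) (use r2 in auto)
      moreover obtain y0' where "dist x y0' = r2" by (rule vector_choose_dist[of r2 x]) (use r2 in auto)
      ultimately have y': "dist x y' = r2 / 2" "dist x y0' = r2" by auto
      then have yD: "y' \<in> D" "y0' \<in> D" "y' \<noteq> x" "y0' \<noteq> x" using r2 r3 by (auto simp: subset_iff)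
      have "\<exists>y0\<in>D - ball x r2. dist (stereo (f y0)) (stereo (f x)) < d" if "0 < d" for d
        using contr that r2(3) by (force simp: dist_commute not_less)
      then have "f y0' = f x"
        by (rule rigid[of "r2 / 2" r2 r3 x x y' y0', rotated 5])
           (use r2 r3 y' yD inj x in \<open>auto simp: inj_on_def\<close>)
      then show False using inj_onD[OF inj] yD x by blast
    qed
  qed
  have "\<exists>g g'. (\<forall>x\<in>D. f x = Some (g x)) \<and> homeomorphism D (g ` D) g g'"
    if "inj_on f D" "\<forall>m. \<forall>x\<in>D. fs m x \<noteq> None"
    using limit_finite[OF assms(1,2,7,9) that(1)] that(2)
    by (intro homeomorphism_of_chordal_homeo[OF homeo[OF that(1)]]) blast
  then show ?thesis using dich homeo by blast
qed

end
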